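(* Let $z\in\mathbb{C}\setminus(-\infty,0]$. Then $$\int_0^\infty \frac{c}{(1+c^2)^2}\,J_0(cz)\,dc=\frac{z}{2}\,K_1(z).$$
   Context: $J_\nu:\mathbb{C}\setminus(-\infty,0]\to\mathbb{C}$ is the Bessel function of the first kind and $K_\nu:\mathbb{C}\setminus(-\infty,0]\to\mathbb{C}$ is the modified Bessel function of the second kind, of order $\nu$.
   Formalization: For non-real z the integral diverges (at z = i the integrand is c I_0(c)/(1+c^2)^2), so what is proved is: convergence and the equation for z > 0, the equation wherever the integral converges, and, for every z off (-∞,0], the equation for its analytic continuation from z > 0. *)

theory Defs
  imports "HOL-Analysis.Analysis"
begin

text \<open>
  Bessel functions of complex order \<open>\<nu>\<close> on the plane slit along the nonpositive real axis.
  \<open>powr\<close> is the principal branch, and \<open>rGamma\<close> is the entire function \<open>1 / \<Gamma>\<close>, so that the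
  terms at the poles of \<open>\<Gamma>\<close> vanish. The values on the slit are irrelevant.
\<close>

definition bessel_J :: "complex \<Rightarrow> complex \<Rightarrow> complex" where
  "bessel_J \<nu> z =
     (z / 2) powr \<nu> * (\<Sum>k. (- 1) ^ k * rGamma (\<nu> + of_nat k + 1) / fact k * (z / 2) ^ (2 * k))"

definition bessel_I :: "complex \<Rightarrow> complex \<Rightarrow> complex" where
  "bessel_I \<nu> z =
     (z / 2) powr \<nu> * (\<Sum>k. rGamma (\<nu> + of_nat k + 1) / fact k * (z / 2) ^ (2 * k))"

definition bessel_K_nonint :: "complex \<Rightarrow> complex \<Rightarrow> complex" where
  "bessel_K_nonint \<nu> z =
     of_real pi / 2 * (bessel_I (- \<nu>) z - bessel_I \<nu> z) / sin (\<nu> * of_real pi)"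

text \<open>At integer order the quotient is \<open>0 / 0\<close>, and \<open>K\<close> is defined by passing to the limit in the order.\<close>

definition bessel_K :: "complex \<Rightarrow> complex \<Rightarrow> complex" where
  "bessel_K \<nu> z =
     (if \<nu> \<in> \<int> then Lim (at \<nu>) (\<lambda>\<mu>. bessel_K_nonint \<mu> z) else bessel_K_nonint \<nu> z)"

text \<open>
  For non-real \<open>z\<close> this grows exponentially in \<open>c\<close>, so its integral over \<open>[0, \<infinity>)\<close> converges
  only for \<open>z > 0\<close> within the slit plane; elsewhere on the slit plane the integral is meaningful
  only through analytic continuation from the positive axis.
\<close>

definition bessel_integrand :: "complex \<Rightarrow> real \<Rightarrow> complex" where
  "bessel_integrand z c = of_real (c / (1 + c\<^sup>2)\<^sup>2) * bessel_J 0 (of_real c * z)"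

end

theory Submission
  imports
    Defs
    "HOL-Complex_Analysis.Complex_Analysis"
    "HOL-Real_Asymp.Real_Asymp"
    "HOL-Probability.Distributions"
begin

text \<open>
  For \<open>x > 0\<close>, inserting \<open>1 / (1 + c\<^sup>2)\<^sup>2 = \<integral> t exp (- t (1 + c\<^sup>2)) dt\<close> and using the Gaussian
  integral of \<open>J\<^sub>0\<close> turns the left-hand side into \<open>M 1 (x\<^sup>2 / 4) / 2\<close>, where
  \<open>M p y = \<integral> t powr (p - 1) exp (- t - y / t) dt\<close> over the positive axis. For \<open>0 < p < 1\<close>,
  differentiation in \<open>y\<close> and the substitution \<open>t \<mapsto> y / t\<close> give
  \<open>(M p)' = - y powr (p - 1) M (1 - p)\<close>, and \<open>M p y\<close> tends to \<open>\<Gamma>(p)\<close> as \<open>y\<close> tends to \<open>0\<close>.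
  The combination of \<open>I\<^bsub>-p\<^esub>\<close> and \<open>I\<^bsub>p\<^esub>\<close> that defines \<open>K\<^bsub>p\<^esub>\<close> satisfies the same coupled
  system with the same initial values, so the two agree by a Gronwall argument; let \<open>p\<close> tend to \<open>1\<close>.
  Since \<open>I\<^bsub>\<mu>\<^esub>\<close> is analytic in the order, the limit that defines \<open>K\<^sub>1\<close> exists and is holomorphic in
  \<open>z\<close>, so \<open>z K\<^sub>1(z) / 2\<close> itself is the analytic continuation. For \<open>z \<notin> \<real>\<close> the integrand
  is not even conditionally integrable.
\<close>

subsection \<open>The entire series of the Bessel functions\<close>

text \<open>The regularised hypergeometric function 0F1, entire in \<open>w\<close>. Apart from the
  branch factor \<open>(z / 2) powr \<nu>\<close>, \<open>bessel_I\<close> is its value at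
  \<open>(z / 2)^2\<close> and \<open>bessel_J\<close> its value at
  \<open>- (z / 2)^2\<close>.\<close>

definition bessel_series :: "complex \<Rightarrow> complex \<Rightarrow> complex" where
  "bessel_series \<nu> w = (\<Sum>k. rGamma (\<nu> + of_nat k + 1) / fact k * w ^ k)"

text \<open>By \<open>rGamma_plus1\<close>, raising \<open>k\<close> by one divides by
  \<open>\<mu> + of_nat k + 1\<close>, of modulus at least 1 once \<open>k\<close> exceeds the
  radius of \<open>X\<close>; compactness handles the finitely many earlier \<open>k\<close>.
  Uniformity in \<open>\<mu>\<close> is what differentiation in the order relies on.\<close>

lemma rGamma_shift_bounded:
  fixes X :: "complex set"
  assumes "compact X"
  shows "\<exists>C. \<forall>k. \<forall>\<mu>\<in>X. norm (rGamma (\<mu> + of_nat k + 1)) \<le> C"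
proof -
  obtain B where B: "\<And>\<mu>. \<mu> \<in> X \<Longrightarrow> norm \<mu> \<le> B"
    using compact_imp_bounded[OF assms] by (auto simp: bounded_iff)
  have "\<exists>C. \<forall>\<mu>\<in>X. norm (rGamma (\<mu> + of_nat k + 1)) \<le> C" for k
  proof -
    have "compact ((\<lambda>\<mu>. rGamma (\<mu> + of_nat k + 1)) ` X)"
      by (intro compact_continuous_image continuous_on_compose2[OF continuous_on_rGamma[of UNIV]]
            continuous_intros assms) auto
    thus ?thesis
      using compact_imp_bounded by (fastforce simp: bounded_iff)
  qed
  then obtain C where C: "\<And>k \<mu>. \<mu> \<in> X \<Longrightarrow> norm (rGamma (\<mu> + of_nat k + 1)) \<le> C k"
    by metis
  define n where "n = nat \<lceil>B\<rceil>"
  define M where "M = Max (C ` {..n})"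
  have "norm (rGamma (\<mu> + of_nat k + 1)) \<le> M" if \<mu>: "\<mu> \<in> X" for k \<mu>
  proof (induction k)
    case 0
    have "C 0 \<le> M" unfolding M_def by (intro Max_ge) auto
    thus ?case using C[OF \<mu>, of 0] by linarith
  next
    case (Suc k)
    show ?case
    proof (cases "Suc k \<le> n")
      case True
      have "C (Suc k) \<le> M" unfolding M_def using True by (intro Max_ge) auto
      thus ?thesis using C[OF \<mu>, of "Suc k"] by linarith
    next
      case False
      hence "real k \<ge> B" unfolding n_def by linarith
      hence "norm (of_nat (Suc k) :: complex) - norm (- \<mu>) \<ge> 1"
        using B[OF \<mu>] unfolding norm_of_nat norm_minus_cancel by simp
      hence ge: "norm (of_nat (Suc k) - (- \<mu>)) \<ge> 1"
        using norm_triangle_ineq2[of "of_nat (Suc k)" "- \<mu>"] by linarith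
      have eq: "\<mu> + of_nat (Suc k) + 1 = (\<mu> + of_nat k + 1) + 1"
        by simp
      have "1 * norm (rGamma (\<mu> + of_nat (Suc k) + 1))
              \<le> norm (\<mu> + of_nat k + 1) * norm (rGamma (\<mu> + of_nat (Suc k) + 1))"
        using ge by (intro mult_right_mono) (simp_all add: algebra_simps)
      also have "\<dots> = norm (rGamma (\<mu> + of_nat k + 1))"
        unfolding eq norm_mult[symmetric] rGamma_plus1 ..
      finally show ?thesis using Suc.IH by linarith
    qed
  qed
  thus ?thesis by blast
qed

lemma norm_bessel_series_term_le:
  fixes w c :: complex
  assumes "norm c \<le> C"
  shows "norm (c / fact k * w ^ k) \<le> C * (norm w ^ k /\<^sub>R fact k)"
proof -
  have "norm (c / fact k * w ^ k) = norm c * (norm w ^ k /\<^sub>R fact k)"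
    by (simp add: norm_mult norm_divide norm_power field_simps)
  thus ?thesis using assms by (simp add: mult_right_mono del: mult_cancel_right)
qed

lemma summable_bessel_series:
  "summable (\<lambda>k. rGamma (\<nu> + of_nat k + 1) / fact k * (w :: complex) ^ k)"
proof -
  obtain C where C: "\<And>k. norm (rGamma (\<nu> + of_nat k + 1)) \<le> C"
    using rGamma_shift_bounded[of "{\<nu>}"] by auto
  show ?thesis
  proof (rule summable_comparison_test')
    show "summable (\<lambda>k. C * (norm w ^ k /\<^sub>R fact k))"
      by (intro summable_mult summable_exp_generic)
    show "norm (rGamma (\<nu> + of_nat k + 1) / fact k * w ^ k) \<le> C * (norm w ^ k /\<^sub>R fact k)"
      if "k \<ge> 0" for k
      using C by (rule norm_bessel_series_term_le)
  qed
qed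

lemma bessel_series_0_right: "bessel_series \<nu> 0 = rGamma (\<nu> + 1)"
  unfolding bessel_series_def
  by (subst powser_zero[of "\<lambda>k. rGamma (\<nu> + of_nat k + 1) / fact k"]) simp

text \<open>The factor \<open>k + 1\<close> produced by termwise differentiation cancels against the
  factorial, so only the order moves.\<close>

lemma has_field_derivative_bessel_series:
  "(bessel_series \<nu> has_field_derivative bessel_series (\<nu> + 1) w) (at w within A)"
proof -
  have "diffs (\<lambda>k. rGamma (\<nu> + of_nat k + 1) / fact k) k = rGamma (\<nu> + 1 + of_nat k + 1) / fact k" for k
    unfolding diffs_def by (simp add: algebra_simps del: of_nat_Suc) (simp add: algebra_simps)
  thus ?thesis
    using termdiffs_strong_converges_everywhere[OF summable_bessel_series[of \<nu>], of w]
    unfolding bessel_series_def by (simp add: has_field_derivative_at_within)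
qed

lemmas has_field_derivative_bessel_series' [derivative_intros] =
  DERIV_chain2[OF has_field_derivative_bessel_series]

lemma continuous_on_bessel_series [continuous_intros]:
  "continuous_on A f \<Longrightarrow> continuous_on A (\<lambda>x. bessel_series \<nu> (f x))"
  by (rule continuous_on_compose2[OF DERIV_continuous_on[OF has_field_derivative_bessel_series]])
    auto

text \<open>Coefficientwise this is \<open>rGamma s = s * rGamma (s + 1)\<close> with
  \<open>s\<close> split as \<open>(\<nu> + 1) + k\<close>; the part with \<open>k\<close> is an
  index shift. As raising the order means differentiating, this is Bessel's differential
  equation.\<close>

lemma bessel_series_recurrence:
  "bessel_series \<nu> w = (\<nu> + 1) * bessel_series (\<nu> + 1) w + w * bessel_series (\<nu> + 2) w"
proof -
  define a where "a \<nu> k = rGamma (\<nu> + of_nat k + 1) / fact k * w ^ k" for \<nu> :: complex and k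
  have sm: "summable (a \<nu>)" for \<nu>
    unfolding a_def by (rule summable_bessel_series)
  have eq: "a \<nu> k = (\<nu> + 1) * a (\<nu> + 1) k + of_nat k * a (\<nu> + 1) k" for k
  proof -
    have "rGamma (\<nu> + of_nat k + 1) = (\<nu> + of_nat k + 1) * rGamma (\<nu> + 1 + of_nat k + 1)"
      using rGamma_plus1[of "\<nu> + of_nat k + 1"] by (simp add: algebra_simps)
    thus ?thesis unfolding a_def by (simp add: field_simps)
  qed
  have shift: "of_nat (Suc k) * a (\<nu> + 1) (Suc k) = w * a (\<nu> + 2) k" for k
    unfolding a_def by (simp add: field_simps del: of_nat_Suc) (simp add: algebra_simps)
  have "(\<lambda>k. of_nat (Suc k) * a (\<nu> + 1) (Suc k)) sums (w * suminf (a (\<nu> + 2)))"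
    unfolding shift by (intro sums_mult summable_sums sm)
  \<comment> \<open>The factor \<open>of_nat k\<close> kills the term at index 0, so undoing the
    shift adds nothing.\<close>
  hence "(\<lambda>k. of_nat k * a (\<nu> + 1) k) sums (w * suminf (a (\<nu> + 2)))"
    by (subst (asm) sums_Suc_iff) simp
  hence "(\<lambda>k. (\<nu> + 1) * a (\<nu> + 1) k + of_nat k * a (\<nu> + 1) k) sums
          ((\<nu> + 1) * suminf (a (\<nu> + 1)) + w * suminf (a (\<nu> + 2)))"
    by (intro sums_add sums_mult summable_sums sm)
  hence "suminf (a \<nu>) = (\<nu> + 1) * suminf (a (\<nu> + 1)) + w * suminf (a (\<nu> + 2))"
    unfolding eq[symmetric] by (rule sums_unique[symmetric])
  thus ?thesis unfolding a_def bessel_series_def .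
qed

text \<open>The coefficient bound, uniform on a ball of orders, permits termwise differentiation in
  the order. The result is a power series in \<open>w\<close> that converges everywhere, hence
  entire; this later makes \<open>K_1\<close> holomorphic.\<close>

lemma bessel_series_order_derivative:
  "\<exists>T. T holomorphic_on UNIV \<and>
       (\<forall>w. ((\<lambda>\<mu>. bessel_series \<mu> w) has_field_derivative T w) (at \<nu>))"
proof -
  obtain C where C: "\<And>k \<mu>. \<mu> \<in> cball \<nu> 1 \<Longrightarrow> norm (rGamma (\<mu> + of_nat k + 1)) \<le> C"
    using rGamma_shift_bounded[OF compact_cball] by blast
  define d where "d k \<mu> = deriv rGamma (\<mu> + of_nat k + 1) / fact k" for k and \<mu> :: complex
  have d: "(\<lambda>k. d k \<nu> * w ^ k) sums suminf (\<lambda>k. d k \<nu> * w ^ k) \<and>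
           ((\<lambda>\<mu>. bessel_series \<mu> w) has_field_derivative (\<Sum>k. d k \<nu> * w ^ k)) (at \<nu>)" for w
  proof -
    have hfd: "((\<lambda>\<mu>. rGamma (\<mu> + of_nat k + 1) / fact k * w ^ k) has_field_derivative d k \<mu> * w ^ k) (at \<mu>)"
      for k \<mu>
    proof -
      have "(rGamma has_field_derivative deriv rGamma (\<mu> + of_nat k + 1)) (at (\<mu> + of_nat k + 1))"
        by (simp only: DERIV_deriv_iff_field_differentiable field_differentiable_rGamma)
      hence "((\<lambda>\<mu>. rGamma (\<mu> + of_nat k + 1)) has_field_derivative deriv rGamma (\<mu> + of_nat k + 1) * 1) (at \<mu>)"
        by (rule DERIV_chain2[where g = "\<lambda>\<mu>. \<mu> + of_nat k + 1"]) (auto intro!: derivative_eq_intros)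
      from DERIV_cmult_right[OF DERIV_cdivide[OF this]] show ?thesis
        unfolding d_def by simp
    qed
    have sm: "summable (\<lambda>k. C * (norm w ^ k /\<^sub>R fact k))"
      by (intro summable_mult summable_exp_generic)
    have bd: "\<forall>\<^sub>F k in sequentially. \<forall>\<mu>\<in>ball \<nu> 1.
            norm (rGamma (\<mu> + of_nat k + 1) / fact k * w ^ k) \<le> C * (norm w ^ k /\<^sub>R fact k)"
      using C by (intro always_eventually allI ballI norm_bessel_series_term_le) auto
    from series_and_derivative_comparison[OF open_ball sm hfd bd]
    obtain g g' where g: "\<forall>\<mu>\<in>ball \<nu> 1. (\<lambda>k. rGamma (\<mu> + of_nat k + 1) / fact k * w ^ k) sums g \<mu>
        \<and> (\<lambda>k. d k \<mu> * w ^ k) sums g' \<mu> \<and> (g has_field_derivative g' \<mu>) (at \<mu>)"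
      by blast
    have gS: "g \<mu> = bessel_series \<mu> w" if "\<mu> \<in> ball \<nu> 1" for \<mu>
      using g that sums_unique unfolding bessel_series_def by blast
    have g\<nu>: "(\<lambda>k. d k \<nu> * w ^ k) sums g' \<nu>" "(g has_field_derivative g' \<nu>) (at \<nu>)"
      using g by auto
    have "((\<lambda>\<mu>. bessel_series \<mu> w) has_field_derivative g' \<nu>) (at \<nu>)"
      using gS by (intro has_field_derivative_transform_within_open[OF g\<nu>(2) open_ball]) auto
    thus ?thesis using g\<nu>(1) sums_unique by (metis sums_summable summable_sums)
  qed
  define T where "T w = (\<Sum>k. d k \<nu> * w ^ k)" for w
  have "(T has_field_derivative (\<Sum>k. diffs (\<lambda>k. d k \<nu>) k * w ^ k)) (at w)" for w
    unfolding T_def using d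
    by (intro termdiffs_strong_converges_everywhere) (metis sums_summable)
  hence "T holomorphic_on UNIV"
    by (auto simp: holomorphic_on_open)
  thus ?thesis using d unfolding T_def by blast
qed

subsection \<open>Boundedness and growth of \<open>J\<^sub>0\<close>\<close>

lemma bessel_J_0_eq:
  assumes "z \<noteq> 0"
  shows "bessel_J 0 z = bessel_series 0 (- (z / 2)\<^sup>2)"
proof -
  have *: "(- 1) ^ k * rGamma (0 + of_nat k + 1) / fact k * (z / 2) ^ (2 * k) =
          rGamma (0 + of_nat k + 1) / fact k * (- (z / 2)\<^sup>2) ^ k" for k
    unfolding power_minus[of "(z / 2)\<^sup>2"] power_mult by simp
  show ?thesis
    unfolding bessel_J_def bessel_series_def * using assms by simp
qed

text \<open>The weight vanishes at \<open>c = 0\<close>, where \<open>bessel_J 0 0\<close> is the junk value \<open>0\<close>.\<close>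

lemma bessel_integrand_eq:
  assumes "z \<noteq> 0"
  shows "bessel_integrand z c =
           of_real (c / (1 + c\<^sup>2)\<^sup>2) * bessel_series 0 (- (of_real c * z / 2)\<^sup>2)"
  using assms bessel_J_0_eq[of "of_real c * z"] by (cases "c = 0") (auto simp: bessel_integrand_def)

lemma has_real_derivative_norm_power2:
  fixes f :: "real \<Rightarrow> complex"
  assumes "(f has_vector_derivative f') (at t within A)"
  shows "((\<lambda>t. (norm (f t))\<^sup>2) has_real_derivative 2 * (f t \<bullet> f')) (at t within A)"
proof -
  have "((\<lambda>t. f t \<bullet> f t) has_vector_derivative f t \<bullet> f' + f' \<bullet> f t) (at t within A)"
    by (rule bounded_bilinear.has_vector_derivative[OF bounded_bilinear_inner assms assms])
  thus ?thesis
    by (simp add: has_real_derivative_iff_has_vector_derivative power2_norm_eq_inner inner_commute)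
qed

lemma has_vector_derivative_bessel_series_comp:
  assumes "(h has_field_derivative h') (at (of_real t))"
  shows "((\<lambda>t. bessel_series \<nu> (h (of_real t))) has_vector_derivative
           bessel_series (\<nu> + 1) (h (of_real t)) * h') (at t within A)"
proof -
  have "((\<lambda>x. bessel_series \<nu> (h x)) has_field_derivative bessel_series (\<nu> + 1) (h (of_real t)) * h')
          (at (of_real t))"
    by (rule has_field_derivative_bessel_series'[OF assms])
  from has_vector_derivative_real_field[OF this] show ?thesis
    by (simp add: has_vector_derivative_at_within)
qed

text \<open>With \<open>f = J\<^sub>0\<close>, the energy \<open>|f|\<^sup>2 + |f'|\<^sup>2\<close> decreases on the positive axis because
  \<open>f'' + f = - f' / t\<close>.\<close>

lemma norm_bessel_series_0_le:
  fixes t :: real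
  assumes "t \<ge> 0"
  shows "norm (bessel_series 0 (- (of_real t / 2)\<^sup>2)) \<le> 1"
proof -
  define S where "S \<nu> t = bessel_series \<nu> (- (of_real t / 2)\<^sup>2)" for \<nu> and t :: real
  \<comment> \<open>\<open>f1\<close> is the derivative of \<open>J_0\<close>, that is
    \<open>- J_1\<close>.\<close>
  define f1 where "f1 t = - (of_real t / 2) * S 1 t" for t :: real
  define e where "e t = (norm (S 0 t))\<^sup>2 + (norm (f1 t))\<^sup>2" for t
  have S': "(S \<nu> has_vector_derivative - (of_real t / 2) * S (\<nu> + 1) t) (at t)" for \<nu> t
    unfolding S_def
    by (rule has_vector_derivative_eq_rhs[OF has_vector_derivative_bessel_series_comp])
       (auto intro!: derivative_eq_intros)
  have f1': "(f1 has_vector_derivative S 1 t / 2 - S 0 t) (at t)" for t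
  proof -
    have "((\<lambda>t. - (of_real t / 2) :: complex) has_vector_derivative - (1/2)) (at t)"
      by (auto intro!: derivative_eq_intros)
    from has_vector_derivative_mult[OF this S'[of 1]]
    have "(f1 has_vector_derivative - (of_real t / 2) * (- (of_real t / 2) * S 2 t) + - (1/2) * S 1 t) (at t)"
      unfolding f1_def by simp
    moreover have "S 0 t = S 1 t - (of_real t / 2)\<^sup>2 * S 2 t"
      using bessel_series_recurrence[of 0 "- (of_real t / 2)\<^sup>2"] unfolding S_def by simp
    ultimately show ?thesis by (simp add: power2_eq_square mult.assoc)
  qed
  \<comment> \<open>This is \<open>- 2 |f'|^2 / t\<close> with the division by \<open>t\<close>
    carried out, so it makes sense at \<open>t = 0\<close> as well.\<close>
  have e': "(e has_real_derivative - (t / 2) * (norm (S 1 t))\<^sup>2) (at t)" for t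
  proof -
    have "(e has_real_derivative 2 * (S 0 t \<bullet> f1 t) + 2 * (f1 t \<bullet> (S 1 t / 2 - S 0 t))) (at t)"
      unfolding e_def
      by (intro DERIV_add has_real_derivative_norm_power2 f1')
         (use S'[of 0] in \<open>simp add: f1_def\<close>)
    also have "2 * (S 0 t \<bullet> f1 t) + 2 * (f1 t \<bullet> (S 1 t / 2 - S 0 t)) = f1 t \<bullet> S 1 t"
      by (simp add: inner_diff_right inner_commute inner_complex_def algebra_simps)
    also have "\<dots> = - (t / 2) * (norm (S 1 t))\<^sup>2"
      unfolding f1_def power2_norm_eq_inner by (simp add: inner_complex_def algebra_simps)
    finally show ?thesis .
  qed
  have "e t \<le> e 0"
    using assms by (intro DERIV_nonpos_imp_nonincreasing[of 0 t e]) (use e' in force)+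
  also have "e 0 = 1"
    unfolding e_def f1_def S_def by (simp add: bessel_series_0_right)
  finally have "(norm (S 0 t))\<^sup>2 \<le> 1\<^sup>2"
    unfolding e_def using zero_le_power2[of "norm (f1 t)"] by (simp only: one_power2)
  thus ?thesis unfolding S_def by (rule power2_le_imp_le) simp
qed

text \<open>For large \<open>t\<close> the definition of the improper gauge integral puts the
  primitive within 1 of the full integral; on the remaining compact interval the primitive is
  continuous. Absolute integrability is not assumed, so conditional convergence is covered.\<close>

lemma integrable_imp_bounded_primitive:
  fixes f :: "real \<Rightarrow> 'a::euclidean_space"
  assumes "f integrable_on {0..}"
  shows "\<exists>M. \<forall>t\<ge>0. norm (integral {0..t} f) \<le> M"
proof -
  obtain I where I: "(f has_integral I) {0..}"
    using assms by blast
  then obtain B where "B > 0" and B: "\<And>a b. ball 0 B \<subseteq> cbox a b \<Longrightarrow>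
      norm (integral (cbox a b) (\<lambda>x. if x \<in> {0..} then f x else 0) - I) < 1"
    unfolding has_integral_alt'[of f] using zero_less_one by blast
  have *: "integral (cbox (- t) t) (\<lambda>x. if x \<in> {0..} then f x else 0) = integral {0..t} f" for t
    unfolding integral_restrict_Int by (rule arg_cong2[where f = integral]) auto
  have int: "f integrable_on {0..t}" for t
    by (rule integrable_on_subinterval[OF assms]) auto
  have large: "norm (integral {0..t} f) \<le> norm I + 1" if "t \<ge> B" for t
  proof -
    have "ball 0 B \<subseteq> cbox (- t) t" using that by (auto simp: dist_real_def)
    from B[OF this] have "norm (integral {0..t} f - I) < 1" unfolding * .
    thus ?thesis using norm_triangle_ineq2[of "integral {0..t} f" I] by linarith
  qed
  have "bounded ((\<lambda>t. integral {0..t} f) ` {0..B})"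
    by (intro compact_imp_bounded compact_continuous_image indefinite_integral_continuous_1 int) simp
  then obtain M where "\<forall>t\<in>{0..B}. norm (integral {0..t} f) \<le> M"
    by (auto simp: bounded_iff)
  hence "norm (integral {0..t} f) \<le> max M (norm I + 1)" if "t \<ge> 0" for t
    using large[of t] that by (cases "t \<le> B") (auto simp: le_max_iff_disj)
  thus ?thesis by blast
qed

text \<open>A bounded primitive of the integrand would make \<open>J\<^sub>0 (c z)\<close> grow at most polynomially,
  by two integrations by parts against the weight; but for \<open>z \<notin> \<real>\<close> the form
  \<open>q = Re (\<omega> c u' cnj u)\<close> with \<open>u = J\<^sub>0 (c z)\<close> satisfies \<open>q' \<ge> 2 |Im z| q\<close>. The factor
  \<open>\<omega> = \<i> cnj z / Im z\<close> is chosen such that \<open>Re \<omega> = 1\<close> and \<open>Re (- \<omega> z\<^sup>2) = |z|\<^sup>2\<close>.\<close>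

lemma not_integrable_bessel_integrand:
  assumes "Im z \<noteq> 0"
  shows "\<not> bessel_integrand z integrable_on {0..}"
proof
  assume "bessel_integrand z integrable_on {0..}"
  then obtain M where M: "\<And>t. t \<ge> 0 \<Longrightarrow> norm (integral {0..t} (bessel_integrand z)) \<le> M"
    using integrable_imp_bounded_primitive by blast
  have z: "z \<noteq> 0" using assms by auto
  define \<kappa> where "\<kappa> = \<bar>Im z\<bar>"
  have \<kappa>: "\<kappa> > 0" using assms by (simp add: \<kappa>_def)
  define S where "S \<nu> c = bessel_series \<nu> (- (of_real c * z / 2)\<^sup>2)" for \<nu> and c :: real
  define u where "u = S 0"
  define u' where "u' c = - (of_real c * z\<^sup>2 / 2) * S 1 c" for c
  define v where "v c = of_real c * u' c" for c
  define w where "w c = c / (1 + c\<^sup>2)\<^sup>2" for c :: real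
  have S': "(S \<nu> has_vector_derivative - (of_real c * z\<^sup>2 / 2) * S (\<nu> + 1) c) (at c within A)" for \<nu> c A
    unfolding S_def
    by (rule has_vector_derivative_eq_rhs[OF has_vector_derivative_bessel_series_comp])
       (auto intro!: derivative_eq_intros simp: power2_eq_square)
  have contS: "continuous_on A (S \<nu>)" for A \<nu>
    by (rule continuous_on_vector_derivative) (rule S')
  have du: "(u has_vector_derivative u' c) (at c within A)" for c A
    using S'[of 0] unfolding u_def u'_def by simp
  \<comment> \<open>Bessel's equation in self-adjoint form:
    \<open>(c u')' = - z^2 c u\<close>.\<close>
  have dv: "(v has_vector_derivative - z\<^sup>2 * of_real c * u c) (at c within A)" for c A
  proof -
    have v_alt: "v = (\<lambda>c. - (of_real c * of_real c * z\<^sup>2 / 2) * S 1 c)"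
      by (auto simp: v_def u'_def)
    have "((\<lambda>c. - (of_real c * of_real c * z\<^sup>2 / 2)) has_vector_derivative - of_real c * z\<^sup>2) (at c within A)"
      by (auto intro!: derivative_eq_intros simp: algebra_simps)
    from has_vector_derivative_mult[OF this S'[of 1]]
    have "(v has_vector_derivative
             - (of_real c * of_real c * z\<^sup>2 / 2) * (- (of_real c * z\<^sup>2 / 2) * S 2 c)
             + - of_real c * z\<^sup>2 * S 1 c) (at c within A)"
      unfolding v_alt by simp
    moreover have "u c = S 1 c - (of_real c * z / 2)\<^sup>2 * S 2 c"
      using bessel_series_recurrence[of 0 "- (of_real c * z / 2)\<^sup>2"] unfolding S_def u_def by simp
    ultimately show ?thesis
      by (elim has_vector_derivative_eq_rhs) (simp only:, simp add: power2_eq_square algebra_simps)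
  qed
  define F where "F t = integral {0..t} (bessel_integrand z)" for t
  have integrand: "bessel_integrand z = (\<lambda>c. of_real (w c) * u c)"
    unfolding w_def u_def S_def by (rule ext) (rule bessel_integrand_eq[OF z])
  have pos: "1 + c\<^sup>2 > (0::real)" for c by (simp add: add_pos_nonneg)
  have contint: "continuous_on A (bessel_integrand z)" for A
    unfolding integrand u_def w_def using pos
    by (intro continuous_intros contS) (auto simp: less_le)
  have dF: "(F has_vector_derivative of_real (w t) * u t) (at t)" if "t > 0" for t
  proof -
    have "(F has_vector_derivative of_real (w t) * u t) (at t within {0..t+1})"
      unfolding F_def using integral_has_vector_derivative[OF contint, of t 0 "t+1"] that
      by (simp add: integrand)
    thus ?thesis using that by (subst (asm) at_within_Icc_at) auto
  qed
  have contF: "continuous_on {0..t} F" for t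
    unfolding F_def by (intro indefinite_integral_continuous_1 integrable_continuous_real contint)
  \<comment> \<open>One half of \<open>K\<close> will bound \<open>\<Phi>\<close>, the other half
    the boundary term \<open>z^2 (1 + c^2)^2 F\<close>.\<close>
  define K where "K = 2 * (norm z)\<^sup>2 * M"
  have "M \<ge> 0" using M[of 0] by simp
  have "norm (v t) \<le> K * (1 + t\<^sup>2)\<^sup>2" if t: "t > 0" for t
  proof -
    \<comment> \<open>Since \<open>c u = (1 + c^2)^2 F'\<close>, adding this boundary term to
      \<open>v\<close> cancels the integrand and leaves a derivative containing only the bounded
      primitive \<open>F\<close>; \<open>\<phi>\<close> is a primitive of the resulting
      bound.\<close>
    define \<Phi> where "\<Phi> c = v c + z\<^sup>2 * (of_real ((1 + c\<^sup>2)\<^sup>2) * F c)" for c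
    define \<phi> where "\<phi> c = (norm z)\<^sup>2 * M * (1 + c\<^sup>2)\<^sup>2" for c :: real
    have dP: "((\<lambda>c. of_real ((1 + c\<^sup>2)\<^sup>2) :: complex) has_vector_derivative of_real (4 * c * (1 + c\<^sup>2))) (at c)" for c
      by (rule has_vector_derivative_of_real)
         (auto intro!: derivative_eq_intros simp: has_real_derivative_iff_has_vector_derivative[symmetric])
    have "norm (\<Phi> t - \<Phi> 0) \<le> \<phi> t - \<phi> 0"
    proof (rule differentiable_bound_general[OF t])
      show "continuous_on {0..t} \<Phi>"
        unfolding \<Phi>_def v_def u'_def by (intro continuous_intros contF contS) auto
      show "continuous_on {0..t} \<phi>"
        unfolding \<phi>_def by (intro continuous_intros)
      fix c assume c: "0 < c" "c < t"
      have "(\<Phi> has_vector_derivative - z\<^sup>2 * of_real c * u c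
              + z\<^sup>2 * (of_real ((1 + c\<^sup>2)\<^sup>2) * (of_real (w c) * u c) + of_real (4 * c * (1 + c\<^sup>2)) * F c)) (at c)"
        unfolding \<Phi>_def using c
        by (intro has_vector_derivative_add dv has_vector_derivative_mult_right has_vector_derivative_mult dP dF) auto
      moreover have "of_real ((1 + c\<^sup>2)\<^sup>2) * (of_real (w c) * u c) = of_real c * u c"
        using pos[of c] unfolding w_def mult.assoc[symmetric] of_real_mult[symmetric] by simp
      ultimately show "(\<Phi> has_vector_derivative z\<^sup>2 * (of_real (4 * c * (1 + c\<^sup>2)) * F c)) (at c)"
        by (elim has_vector_derivative_eq_rhs) (simp only:, simp add: algebra_simps)
      show "(\<phi> has_vector_derivative (norm z)\<^sup>2 * M * (4 * c * (1 + c\<^sup>2))) (at c)"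
        unfolding \<phi>_def has_real_derivative_iff_has_vector_derivative[symmetric]
        by (auto intro!: derivative_eq_intros simp: algebra_simps)
      have "norm (z\<^sup>2 * (of_real (4 * c * (1 + c\<^sup>2)) * F c)) = (norm z)\<^sup>2 * (4 * c * (1 + c\<^sup>2)) * norm (F c)"
        using c pos[of c] by (simp only: norm_mult norm_power norm_of_real) simp
      also have "\<dots> \<le> (norm z)\<^sup>2 * (4 * c * (1 + c\<^sup>2)) * M"
        using M[of c] c pos[of c] by (intro mult_left_mono) (auto simp: F_def)
      finally show "norm (z\<^sup>2 * (of_real (4 * c * (1 + c\<^sup>2)) * F c)) \<le> (norm z)\<^sup>2 * M * (4 * c * (1 + c\<^sup>2))"
        by (simp add: mult_ac)
    qed
    moreover have "\<Phi> 0 = 0" unfolding \<Phi>_def v_def F_def by simp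
    moreover have "\<phi> 0 \<ge> 0" unfolding \<phi>_def using \<open>M \<ge> 0\<close> by simp
    ultimately have 1: "norm (\<Phi> t) \<le> (norm z)\<^sup>2 * M * (1 + t\<^sup>2)\<^sup>2"
      unfolding \<phi>_def by simp
    have "norm (z\<^sup>2 * (of_real ((1 + t\<^sup>2)\<^sup>2) * F t)) = (norm z)\<^sup>2 * (1 + t\<^sup>2)\<^sup>2 * norm (F t)"
      using pos[of t] by (simp only: norm_mult norm_power norm_of_real) simp
    also have "\<dots> \<le> (norm z)\<^sup>2 * (1 + t\<^sup>2)\<^sup>2 * M"
      using M[of t] t by (intro mult_left_mono) (auto simp: F_def)
    finally have 2: "norm (z\<^sup>2 * (of_real ((1 + t\<^sup>2)\<^sup>2) * F t)) \<le> (norm z)\<^sup>2 * (1 + t\<^sup>2)\<^sup>2 * M" .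
    have "norm (v t) = norm (\<Phi> t - z\<^sup>2 * (of_real ((1 + t\<^sup>2)\<^sup>2) * F t))"
      unfolding \<Phi>_def by simp
    thus ?thesis
      using norm_triangle_ineq4[of "\<Phi> t" "z\<^sup>2 * (of_real ((1 + t\<^sup>2)\<^sup>2) * F t)"] 1 2
      unfolding K_def by (simp add: algebra_simps)
  qed
  note v_le = this
  have K0: "K \<ge> 0" using \<open>M \<ge> 0\<close> by (simp add: K_def)
  define L where "L = norm (u 1)"
  \<comment> \<open>Starting at 1 gives \<open>|u'| \<le> |v|\<close>, because
    \<open>v = c u'\<close>. The factor \<open>6 c\<close>, at least 1 there, is inserted so that
    the bound has the primitive \<open>K (1 + c^2)^3\<close>.\<close>
  have u_le: "norm (u t) \<le> L + K * (1 + t\<^sup>2) ^ 3" if t: "t > 1" for t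
  proof -
    define \<phi> where "\<phi> c = K * (1 + c\<^sup>2) ^ 3" for c :: real
    have "norm (u t - u 1) \<le> \<phi> t - \<phi> 1"
    proof (rule differentiable_bound_general[OF t])
      show "continuous_on {1..t} u" unfolding u_def by (rule contS)
      show "continuous_on {1..t} \<phi>" unfolding \<phi>_def by (intro continuous_intros)
      fix c assume c: "1 < c" "c < t"
      show "(u has_vector_derivative u' c) (at c)" by (rule du)
      show "(\<phi> has_vector_derivative K * (6 * c * (1 + c\<^sup>2)\<^sup>2)) (at c)"
        unfolding \<phi>_def has_real_derivative_iff_has_vector_derivative[symmetric]
        by (auto intro!: derivative_eq_intros simp: algebra_simps)
      have "1 * norm (u' c) \<le> c * norm (u' c)"
        using c by (intro mult_right_mono) auto
      also have "\<dots> = norm (v c)" using c by (simp add: v_def norm_mult)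
      also have "\<dots> \<le> K * (1 * (1 + c\<^sup>2)\<^sup>2)" using v_le[of c] c by simp
      also have "\<dots> \<le> K * (6 * c * (1 + c\<^sup>2)\<^sup>2)"
        using c K0 by (intro mult_left_mono mult_right_mono) auto
      finally show "norm (u' c) \<le> K * (6 * c * (1 + c\<^sup>2)\<^sup>2)" by simp
    qed
    moreover have "\<phi> 1 \<ge> 0" using K0 by (simp add: \<phi>_def)
    ultimately show ?thesis
      using norm_triangle_ineq2[of "u t" "u 1"] unfolding L_def \<phi>_def by linarith
  qed
  define \<omega> where "\<omega> = \<i> * cnj z / of_real (Im z)"
  define q where "q c = Re (\<omega> * (v c * cnj (u c)))" for c
  define q' where "q' c = c * ((norm (u' c))\<^sup>2 + (norm z)\<^sup>2 * (norm (u c))\<^sup>2)" for c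
  have dq: "(q has_real_derivative q' c) (at c within A)" for c A
  proof -
    have "((\<lambda>c. cnj (u c)) has_vector_derivative cnj (u' c)) (at c within A)"
      by (rule bounded_linear.has_vector_derivative[OF bounded_linear_cnj du])
    from has_vector_derivative_mult[OF dv this]
    have "((\<lambda>c. \<omega> * (v c * cnj (u c))) has_vector_derivative
            \<omega> * (v c * cnj (u' c) + - z\<^sup>2 * of_real c * u c * cnj (u c))) (at c within A)"
      by (rule has_vector_derivative_mult_right)
    hence "(q has_vector_derivative
            Re (\<omega> * (v c * cnj (u' c) + - z\<^sup>2 * of_real c * u c * cnj (u c)))) (at c within A)"
      unfolding q_def by (rule bounded_linear.has_vector_derivative[OF bounded_linear_Re])
    moreover define X where "X = - \<omega> * z\<^sup>2"
    have "\<omega> * (v c * cnj (u' c) + - z\<^sup>2 * of_real c * u c * cnj (u c))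
       = of_real (c * (norm (u' c))\<^sup>2) * \<omega> + of_real (c * (norm (u c))\<^sup>2) * X"
      unfolding v_def X_def of_real_mult complex_norm_square by (simp add: algebra_simps)
    hence "Re (\<omega> * (v c * cnj (u' c) + - z\<^sup>2 * of_real c * u c * cnj (u c)))
       = c * (norm (u' c))\<^sup>2 * Re \<omega> + c * (norm (u c))\<^sup>2 * Re X"
      by (simp only: plus_complex.sel times_complex.sel Re_complex_of_real Im_complex_of_real)
    moreover have "Re \<omega> = 1" using assms by (simp add: \<omega>_def Re_divide_of_real)
    moreover have "X = - \<i> * z * of_real ((norm z)\<^sup>2) / of_real (Im z)"
      unfolding X_def \<omega>_def complex_norm_square by (simp add: power2_eq_square)
    hence "Re X = (norm z)\<^sup>2"
      using assms by (simp only: Re_divide_of_real) simp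
    ultimately show ?thesis
      unfolding q'_def has_real_derivative_iff_has_vector_derivative
      by (elim has_vector_derivative_eq_rhs) (simp only:, simp add: algebra_simps)
  qed
  \<comment> \<open>Here \<open>|\<omega>| = |z| / \<kappa>\<close>, so \<open>\<kappa>\<close>
    cancels and the inequality is \<open>2 a b \<le> a^2 + b^2\<close> for \<open>a = |u'|\<close>
    and \<open>b = |z| |u|\<close>.\<close>
  have q_ge: "2 * \<kappa> * q c \<le> q' c" if "c \<ge> 0" for c
  proof -
    have "q c \<le> norm (\<omega> * (v c * cnj (u c)))"
      unfolding q_def by (rule complex_Re_le_cmod)
    also have "\<dots> = norm z / \<kappa> * (c * norm (u' c) * norm (u c))"
      using that by (simp add: \<omega>_def v_def \<kappa>_def norm_mult norm_divide)
    finally have "2 * \<kappa> * q c \<le> 2 * \<kappa> * (norm z / \<kappa> * (c * norm (u' c) * norm (u c)))"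
      using \<kappa> by (intro mult_left_mono) auto
    also have "\<dots> = c * (2 * norm (u' c) * (norm z * norm (u c)))" using \<kappa> by simp
    also have "\<dots> \<le> c * ((norm (u' c))\<^sup>2 + (norm z * norm (u c))\<^sup>2)"
      using sum_squares_bound[of "norm (u' c)" "norm z * norm (u c)"] that by (intro mult_left_mono) auto
    finally show ?thesis unfolding q'_def by (simp add: power_mult_distrib)
  qed
  have q'_nonneg: "q' c \<ge> 0" if "c \<ge> 0" for c
    using that unfolding q'_def by simp
  have q0: "q 0 = 0" by (simp add: q_def v_def)
  have q_mono: "q a \<le> q b" if "0 \<le> a" "a \<le> b" for a b
    using that by (intro DERIV_nonneg_imp_nondecreasing[of a b q]) (use dq q'_nonneg in force)+
  \<comment> \<open>Otherwise the increasing function \<open>q\<close> vanishes on the unit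
    interval. Then \<open>q' = 0\<close> forces \<open>u = 0\<close> inside it, contradicting
    \<open>u 0 = J_0(0) = 1\<close>.\<close>
  have q1: "q 1 > 0"
  proof (rule ccontr)
    assume "\<not> q 1 > 0"
    hence q_zero: "q c = 0" if "c \<in> {0..1}" for c
      using that q_mono[of 0 c] q_mono[of c 1] q0 by auto
    have u_zero: "u c = 0" if "c \<in> {0<..<1}" for c
    proof -
      have "(q has_real_derivative 0) (at c)"
        by (rule has_field_derivative_transform_within_open[of "\<lambda>_. 0" _ _ "{0<..<1}"])
           (use that q_zero in auto)
      hence "q' c = 0" using dq DERIV_unique by blast
      thus ?thesis using that z by (auto simp: q'_def add_nonneg_eq_0_iff)
    qed
    have "(u \<longlongrightarrow> u 0) (at_right 0)"
      using contS[of UNIV 0] unfolding u_def continuous_on_eq_continuous_at[OF open_UNIV]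
      by (auto simp: isCont_def intro: filterlim_mono at_le)
    moreover have "\<forall>\<^sub>F c in at_right 0. u c = 0"
      using eventually_at_right_real[of 0 1] by (rule eventually_mono) (use u_zero in auto)
    hence "(u \<longlongrightarrow> 0) (at_right 0)"
      by (rule tendsto_eventually)
    ultimately have "u 0 = 0"
      by (rule tendsto_unique[OF trivial_limit_at_right_real])
    thus False by (simp add: u_def S_def bessel_series_0_right)
  qed
  have q_exp: "q 1 * exp (- 2 * \<kappa>) \<le> q t * exp (- 2 * \<kappa> * t)" if "t \<ge> 1" for t
  proof -
    have deriv: "((\<lambda>t. q t * exp (- 2 * \<kappa> * t)) has_real_derivative
             (q' t - 2 * \<kappa> * q t) * exp (- 2 * \<kappa> * t)) (at t)" for t
    proof -
      have "((\<lambda>t. exp (- 2 * \<kappa> * t)) has_real_derivative exp (- 2 * \<kappa> * t) * (- 2 * \<kappa>)) (at t)"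
        by (intro DERIV_fun_exp DERIV_cmult_Id)
      from DERIV_mult[OF dq this] show ?thesis
        by (simp add: algebra_simps)
    qed
    have "q 1 * exp (- 2 * \<kappa> * 1) \<le> q t * exp (- 2 * \<kappa> * t)"
    proof (rule DERIV_nonneg_imp_nondecreasing[OF that])
      fix s :: real assume "1 \<le> s"
      hence "0 \<le> (q' s - 2 * \<kappa> * q s) * exp (- 2 * \<kappa> * s)"
        using q_ge[of s] by simp
      with deriv show "\<exists>D. ((\<lambda>t. q t * exp (- 2 * \<kappa> * t)) has_real_derivative D) (at s) \<and> 0 \<le> D"
        by blast
    qed
    thus ?thesis by simp
  qed
  have q_le: "q t \<le> norm \<omega> * (K * (1 + t\<^sup>2)\<^sup>2 * (L + K * (1 + t\<^sup>2) ^ 3))" if "t > 1" for t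
  proof -
    have "q t \<le> norm (\<omega> * (v t * cnj (u t)))"
      unfolding q_def by (rule complex_Re_le_cmod)
    also have "\<dots> = norm \<omega> * (norm (v t) * norm (u t))" by (simp add: norm_mult)
    also have "\<dots> \<le> norm \<omega> * (K * (1 + t\<^sup>2)\<^sup>2 * (L + K * (1 + t\<^sup>2) ^ 3))"
      using v_le[of t] u_le[of t] that K0 by (intro mult_left_mono mult_mono) auto
    finally show ?thesis .
  qed
  have "q 1 * exp (- 2 * \<kappa>) \<le>
          norm \<omega> * (K * (1 + t\<^sup>2)\<^sup>2 * (L + K * (1 + t\<^sup>2) ^ 3)) * exp (- 2 * \<kappa> * t)"
    if "t > 1" for t
    by (rule order_trans[OF q_exp mult_right_mono[OF q_le]]) (use that in auto)
  hence "\<forall>\<^sub>F t in at_top. q 1 * exp (- 2 * \<kappa>) \<le>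
          norm \<omega> * (K * (1 + t\<^sup>2)\<^sup>2 * (L + K * (1 + t\<^sup>2) ^ 3)) * exp (- 2 * \<kappa> * t)"
    by (rule eventually_mono[OF eventually_gt_at_top])
  moreover have "((\<lambda>t::real. norm \<omega> * (K * (1 + t\<^sup>2)\<^sup>2 * (L + K * (1 + t\<^sup>2) ^ 3)) * exp (- 2 * \<kappa> * t)) \<longlongrightarrow> 0) at_top"
  proof -
    have "((\<lambda>t::real. (1 + t\<^sup>2)\<^sup>2 * exp (- 2 * \<kappa> * t)) \<longlongrightarrow> 0) at_top"
         "((\<lambda>t::real. (1 + t\<^sup>2)\<^sup>2 * (1 + t\<^sup>2)^3 * exp (- 2 * \<kappa> * t)) \<longlongrightarrow> 0) at_top"
      using \<kappa> by real_asymp+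
    hence "((\<lambda>t::real. norm \<omega> * K * L * ((1 + t\<^sup>2)\<^sup>2 * exp (- 2 * \<kappa> * t))
              + norm \<omega> * K * K * ((1 + t\<^sup>2)\<^sup>2 * (1 + t\<^sup>2)^3 * exp (- 2 * \<kappa> * t)))
            \<longlongrightarrow> norm \<omega> * K * L * 0 + norm \<omega> * K * K * 0) at_top"
      by (intro tendsto_intros)
    thus ?thesis by (simp add: algebra_simps)
  qed
  ultimately have "q 1 * exp (- 2 * \<kappa>) \<le> 0"
    by (intro tendsto_lowerbound) auto
  thus False using q1 by (simp add: mult_le_0_iff)
qed

subsection \<open>Dependence on the order\<close>

lemma bessel_I_eq:
  assumes "z \<noteq> 0"
  shows "bessel_I \<nu> z = exp (\<nu> * Ln (z / 2)) * bessel_series \<nu> ((z / 2)\<^sup>2)"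
  using assms unfolding bessel_I_def bessel_series_def by (simp add: powr_def power_mult)

text \<open>The product rule on the exponential form of \<open>bessel_I\<close>. The order
  derivative exists for all nonzero \<open>z\<close>; holomorphy in \<open>z\<close> is claimed off
  the slit only, where \<open>Ln\<close> is holomorphic.\<close>

lemma has_field_derivative_bessel_I_order:
  "\<exists>T. T holomorphic_on (- \<real>\<^sub>\<le>\<^sub>0) \<and>
       (\<forall>z. z \<noteq> 0 \<longrightarrow> ((\<lambda>\<mu>. bessel_I \<mu> z) has_field_derivative T z) (at \<nu>))"
proof -
  obtain T where T: "T holomorphic_on UNIV"
      "\<And>w. ((\<lambda>\<mu>. bessel_series \<mu> w) has_field_derivative T w) (at \<nu>)"
    using bessel_series_order_derivative by blast
  define R where "R z = exp (\<nu> * Ln (z / 2)) *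
      (Ln (z / 2) * bessel_series \<nu> ((z / 2)\<^sup>2) + T ((z / 2)\<^sup>2))" for z
  have half: "z / 2 \<notin> \<real>\<^sub>\<le>\<^sub>0" if "z \<notin> \<real>\<^sub>\<le>\<^sub>0" for z :: complex
    using that by (auto simp: complex_nonpos_Reals_iff)
  have "bessel_series \<nu> holomorphic_on UNIV"
    using has_field_derivative_bessel_series by (auto simp: holomorphic_on_open)
  hence "(bessel_series \<nu> \<circ> (\<lambda>z. (z / 2)\<^sup>2)) holomorphic_on (- \<real>\<^sub>\<le>\<^sub>0)"
        "(T \<circ> (\<lambda>z. (z / 2)\<^sup>2)) holomorphic_on (- \<real>\<^sub>\<le>\<^sub>0)"
    using T(1) by (intro holomorphic_on_compose_gen[of _ _ _ UNIV] holomorphic_intros; simp)+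
  hence "R holomorphic_on (- \<real>\<^sub>\<le>\<^sub>0)"
    unfolding R_def o_def using half by (intro holomorphic_intros) auto
  moreover have "((\<lambda>\<mu>. bessel_I \<mu> z) has_field_derivative R z) (at \<nu>)" if "z \<noteq> 0" for z
    unfolding bessel_I_eq[OF that] R_def
    by (auto intro!: derivative_eq_intros T(2) simp: algebra_simps)
  ultimately show ?thesis by blast
qed

text \<open>At \<open>\<nu> = - 1\<close> the recurrence loses its first term, and the remaining
  factor \<open>w\<close> turns \<open>(z / 2)\<close> to the power -1 into the power 1.\<close>

lemma bessel_I_minus_1:
  assumes "z \<noteq> 0"
  shows "bessel_I (- 1) z = bessel_I 1 z"
  using assms bessel_series_recurrence[of "- 1" "(z / 2)\<^sup>2"]
  by (simp add: bessel_I_eq exp_minus power2_eq_square field_simps)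

text \<open>L'Hopital's rule in the order: numerator and sine both vanish at 1, and the sine has
  derivative \<open>- pi\<close> there. The limit is a combination of the order derivatives at 1 and
  -1, which are holomorphic in \<open>z\<close>.\<close>

lemma bessel_K_nonint_limit_holomorphic:
  "\<exists>D. D holomorphic_on (- \<real>\<^sub>\<le>\<^sub>0) \<and>
       (\<forall>z. z \<noteq> 0 \<longrightarrow> ((\<lambda>\<mu>. bessel_K_nonint \<mu> z) \<longlongrightarrow> D z) (at 1))"
proof -
  obtain T where T: "T holomorphic_on (- \<real>\<^sub>\<le>\<^sub>0)"
      "\<And>z. z \<noteq> 0 \<Longrightarrow> ((\<lambda>\<mu>. bessel_I \<mu> z) has_field_derivative T z) (at 1)"
    using has_field_derivative_bessel_I_order[of 1] by blast
  obtain U where U: "U holomorphic_on (- \<real>\<^sub>\<le>\<^sub>0)"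
      "\<And>z. z \<noteq> 0 \<Longrightarrow> ((\<lambda>\<mu>. bessel_I \<mu> z) has_field_derivative U z) (at (- 1))"
    using has_field_derivative_bessel_I_order[of "- 1"] by blast
  define D where "D z = of_real pi / 2 * ((- U z - T z) / (- of_real pi))" for z
  have "D holomorphic_on (- \<real>\<^sub>\<le>\<^sub>0)"
    unfolding D_def by (intro holomorphic_intros T(1) U(1)) auto
  moreover have "((\<lambda>\<mu>. bessel_K_nonint \<mu> z) \<longlongrightarrow> D z) (at 1)" if z: "z \<noteq> 0" for z
  proof -
    define N where "N \<mu> = bessel_I (- \<mu>) z - bessel_I \<mu> z" for \<mu>
    define s where "s \<mu> = sin (\<mu> * of_real pi)" for \<mu> :: complex
    have s1: "s 1 = 0" "cos (of_real pi :: complex) = - 1"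
      unfolding s_def by (simp_all flip: sin_of_real cos_of_real)
    have "((\<lambda>\<mu>. bessel_I (- \<mu>) z) has_field_derivative U z * (- 1)) (at 1)"
      by (rule DERIV_chain2[where g = uminus]) (auto intro!: derivative_eq_intros U(2) z)
    hence "(N has_field_derivative - U z - T z) (at 1)"
      unfolding N_def by (auto intro!: derivative_eq_intros T(2) z)
    hence N: "((\<lambda>\<mu>. (N \<mu> - N 1) / (\<mu> - 1)) \<longlongrightarrow> - U z - T z) (at 1)"
      by (simp add: has_field_derivative_iff)
    have "(s has_field_derivative - of_real pi) (at 1)"
      unfolding s_def using s1(2) by (auto intro!: derivative_eq_intros)
    hence s: "((\<lambda>\<mu>. (s \<mu> - s 1) / (\<mu> - 1)) \<longlongrightarrow> - of_real pi) (at 1)"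
      by (simp add: has_field_derivative_iff)
    have "((\<lambda>\<mu>. of_real pi / 2 * (((N \<mu> - N 1) / (\<mu> - 1)) / ((s \<mu> - s 1) / (\<mu> - 1)))) \<longlongrightarrow> D z) (at 1)"
      unfolding D_def by (intro tendsto_intros N s) auto
    moreover have "\<forall>\<^sub>F \<mu> in at 1. of_real pi / 2 * (((N \<mu> - N 1) / (\<mu> - 1)) / ((s \<mu> - s 1) / (\<mu> - 1)))
        = bessel_K_nonint \<mu> z"
      by (rule eventually_mono[OF eventually_neq_at_within[of 1]])
         (use s1 bessel_I_minus_1[OF z] in \<open>simp add: bessel_K_nonint_def N_def s_def\<close>)
    ultimately show ?thesis by (rule Lim_transform_eventually)
  qed
  ultimately show ?thesis by blast
qed

text \<open>\<open>Lim\<close> is a definite description, so existence of the limit must come first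
  for \<open>bessel_K 1\<close> to have its intended value.\<close>

lemma bessel_K_nonint_tendsto:
  assumes "z \<noteq> 0"
  shows "((\<lambda>\<mu>. bessel_K_nonint \<mu> z) \<longlongrightarrow> bessel_K 1 z) (at 1)"
  using bessel_K_nonint_limit_holomorphic assms by (auto simp: bessel_K_def tendsto_Lim)

lemma bessel_K_1_holomorphic: "bessel_K 1 holomorphic_on (- \<real>\<^sub>\<le>\<^sub>0)"
proof -
  obtain D where D: "D holomorphic_on (- \<real>\<^sub>\<le>\<^sub>0)"
      "\<And>z. z \<noteq> 0 \<Longrightarrow> ((\<lambda>\<mu>. bessel_K_nonint \<mu> z) \<longlongrightarrow> D z) (at 1)"
    using bessel_K_nonint_limit_holomorphic by blast
  have "D z = bessel_K 1 z" if "z \<in> - \<real>\<^sub>\<le>\<^sub>0" for z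
  proof -
    from that have "z \<noteq> 0" by auto
    from D(2)[OF this] bessel_K_nonint_tendsto[OF this] show ?thesis
      by (rule tendsto_unique[rotated]) simp
  qed
  with D(1) show ?thesis by (rule holomorphic_transform)
qed

subsection \<open>The integral representation of \<open>K\<close>\<close>

lemma has_integral_Gamma_real:
  assumes "p > (0::real)"
  shows "((\<lambda>t. t powr (p - 1) * exp (- t)) has_integral Gamma p) {0<..}"
proof -
  have "((\<lambda>t. t powr (p - 1) * exp (- t)) has_integral Gamma p) {0..}"
    using Gamma_integral_real[OF assms] by (simp add: exp_minus divide_inverse)
  moreover have "{t \<in> {0..} - {0<..}. P t} \<subseteq> {0}" "{t \<in> {0<..} - {0..}. P t} = {}" for P :: "real \<Rightarrow> bool"
    by auto
  ultimately show ?thesis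
    by (subst (asm) has_integral_spike_set_eq[where T = "{0<..}"])
       (auto intro: negligible_subset[of "{0}"])
qed

section \<open>Convergence, derivative, reflection and limits of the Macdonald integral\<close>

lemma has_integral_norm_le:
  fixes f :: "'a::euclidean_space \<Rightarrow> 'b::banach" and g :: "'a \<Rightarrow> real"
  assumes "(f has_integral i) S" "(g has_integral j) S"
    and "\<And>x. x \<in> S \<Longrightarrow> norm (f x) \<le> g x"
  shows "norm i \<le> j"
  using integral_norm_bound_integral[of f S g] assms by (auto simp: has_integral_iff)

text \<open>Raise \<open>v / a \<le> exp (v / a)\<close> to the power \<open>a\<close>. With
  \<open>v = y / t\<close> this trades the decay at \<open>t = 0\<close> for any desired power of
  \<open>t\<close>.\<close>

lemma exp_minus_le_powr:
  assumes "a > 0" "v > (0::real)"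
  shows "exp (- v) \<le> (a / v) powr a"
proof -
  have "(v / a) powr a \<le> exp (v / a) powr a"
    using assms exp_ge_add_one_self[of "v / a"] by (intro powr_mono2) (auto simp del: exp_ge_add_one_self)
  also have "\<dots> = exp v" using assms by (simp add: powr_def)
  finally have "inverse (exp v) \<le> inverse ((v / a) powr a)"
    using assms by (intro le_imp_inverse_le) auto
  also have "\<dots> = (a / v) powr a"
    using assms by (simp add: powr_divide)
  finally show ?thesis by (simp add: exp_minus)
qed

text \<open>In classical terms this is \<open>2 y^(p/2) K_p(2 sqrt y)\<close>; for
  \<open>0 < p < 1\<close> that is the content of
  \<open>bessel_K_nonint_eq_macdonald_integral\<close>.\<close>

definition macdonald_integral :: "real \<Rightarrow> real \<Rightarrow> real" where
  "macdonald_integral p y = integral {0<..} (\<lambda>t. t powr (p - 1) * exp (- t - y / t))"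

lemma macdonald_absolutely_integrable:
  assumes "y > 0"
  shows "(\<lambda>t::real. t powr (p - 1) * exp (- t - y / t)) absolutely_integrable_on {0<..}"
proof (rule measurable_bounded_by_integrable_imp_absolutely_integrable)
  \<comment> \<open>This \<open>a\<close> makes \<open>p + a\<close> positive, so that a convergent
    Gamma integral dominates whatever the sign of \<open>p\<close>.\<close>
  define a where "a = \<bar>p\<bar> + 1"
  have a: "a > 0" "p + a > 0" by (auto simp: a_def)
  have "continuous_on {0<..} (\<lambda>t::real. t powr (p - 1) * exp (- t - y / t))"
    by (intro continuous_intros) auto
  thus "(\<lambda>t::real. t powr (p - 1) * exp (- t - y / t)) \<in> borel_measurable (lebesgue_on {0<..})"
    by (intro continuous_imp_measurable_on_sets_lebesgue) auto
  show "(\<lambda>t::real. (a / y) powr a * (t powr (p + a - 1) * exp (- t))) integrable_on {0<..}"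
    using has_integral_Gamma_real[OF a(2)] by (intro integrable_on_mult_right) blast
  show "norm (t powr (p - 1) * exp (- t - y / t)) \<le> (a / y) powr a * (t powr (p + a - 1) * exp (- t))"
    if "t \<in> {0<..}" for t
  proof -
    from that have t: "t > 0" by simp
    have "norm (t powr (p - 1) * exp (- t - y / t)) = t powr (p - 1) * exp (- t) * exp (- (y / t))"
      by (simp add: abs_mult exp_diff exp_minus field_simps)
    also have "\<dots> \<le> t powr (p - 1) * exp (- t) * (a / (y / t)) powr a"
      using assms t a by (intro mult_left_mono exp_minus_le_powr) auto
    also have "a / (y / t) = (a / y) * t" by simp
    also have "\<dots> powr a = (a / y) powr a * t powr a"
      by (rule powr_mult)
    also have "t powr (p - 1) * exp (- t) * ((a / y) powr a * t powr a)
        = (a / y) powr a * (t powr (p + a - 1) * exp (- t))"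
      by (simp add: powr_add[symmetric] algebra_simps)
    finally show ?thesis .
  qed
qed auto

lemma macdonald_has_integral:
  assumes "y > 0"
  shows "((\<lambda>t::real. t powr (p - 1) * exp (- t - y / t)) has_integral macdonald_integral p y) {0<..}"
  unfolding macdonald_integral_def
  using macdonald_absolutely_integrable[OF assms, of p]
  by (intro integrable_integral) (simp add: absolutely_integrable_on_def)

text \<open>A crude Taylor remainder from two uses of \<open>1 + x \<le> exp x\<close>. The loss
  \<open>exp |v|\<close> is affordable: half of the exponent \<open>- y / t\<close> absorbs it
  below.\<close>

lemma abs_exp_diff_linear_le:
  fixes v :: real
  shows "\<bar>exp v - 1 - v\<bar> \<le> v\<^sup>2 * exp \<bar>v\<bar>"
proof -
  have 1: "exp v - 1 \<le> v * exp v"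
    using mult_left_mono[OF exp_ge_add_one_self[of "- v"], of "exp v"]
    by (simp add: algebra_simps flip: exp_add)
  have "exp v - 1 - v \<le> v * (exp v - 1)"
    using 1 by (simp add: algebra_simps)
  also have "\<dots> \<le> \<bar>v\<bar> * \<bar>exp v - 1\<bar>" by (simp flip: abs_mult)
  also have "\<dots> \<le> \<bar>v\<bar> * (\<bar>v\<bar> * exp \<bar>v\<bar>)"
  proof (rule mult_left_mono)
    show "\<bar>exp v - 1\<bar> \<le> \<bar>v\<bar> * exp \<bar>v\<bar>"
    proof (cases "v \<ge> 0")
      case True thus ?thesis using 1 by simp
    next
      case False
      hence "\<bar>exp v - 1\<bar> \<le> \<bar>v\<bar> * 1"
        using exp_ge_add_one_self[of v] by (simp add: abs_if del: exp_ge_add_one_self)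
      also have "\<dots> \<le> \<bar>v\<bar> * exp \<bar>v\<bar>" by (intro mult_left_mono) auto
      finally show ?thesis .
    qed
  qed simp
  also have "\<dots> = v\<^sup>2 * exp \<bar>v\<bar>"
    by (simp add: power2_eq_square flip: mult.assoc)
  finally have "exp v - 1 - v \<le> v\<^sup>2 * exp \<bar>v\<bar>" .
  moreover have "0 \<le> exp v - 1 - v"
    using exp_ge_add_one_self[of v] by linarith
  ultimately show ?thesis by (simp only: abs_of_nonneg)
qed

text \<open>Differentiation under the integral sign with an explicit remainder. With
  \<open>v = - h / t\<close> the factor \<open>v^2\<close> lowers the order by two, and
  \<open>|h| < y / 2\<close> lets \<open>exp |v|\<close> be absorbed by replacing \<open>y\<close>
  with \<open>y / 2\<close>; hence the constant \<open>C\<close>.\<close>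

lemma has_real_derivative_macdonald:
  assumes "y > 0"
  shows "(macdonald_integral p has_real_derivative - macdonald_integral (p - 1) y) (at y)"
proof -
  define C where "C = macdonald_integral (p - 2) (y / 2)"
  let ?f = "\<lambda>p y t. t powr (p - 1) * exp (- t - y / t) :: real"
  have est: "\<bar>macdonald_integral p (y + h) - macdonald_integral p y + h * macdonald_integral (p - 1) y\<bar> \<le> h\<^sup>2 * C"
    if h: "\<bar>h\<bar> < y / 2" for h
  proof -
    have yh: "y + h > 0" using h assms by linarith
    have "((\<lambda>t. ?f p (y + h) t - ?f p y t + h * ?f (p - 1) y t) has_integral
            macdonald_integral p (y + h) - macdonald_integral p y + h * macdonald_integral (p - 1) y) {0<..}"
      by (intro has_integral_add has_integral_diff has_integral_mult_right macdonald_has_integral assms yh)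
    moreover have "((\<lambda>t. h\<^sup>2 * ?f (p - 2) (y / 2) t) has_integral h\<^sup>2 * C) {0<..}"
      unfolding C_def using assms by (intro has_integral_mult_right macdonald_has_integral) auto
    moreover have "norm (?f p (y + h) t - ?f p y t + h * ?f (p - 1) y t) \<le> h\<^sup>2 * ?f (p - 2) (y / 2) t"
      if "t \<in> {0<..}" for t
    proof -
      from that have t: "t > 0" by simp
      define v where "v = - h / t"
      have p1: "t powr (p - 1 - 1) = t powr (p - 1) / t" "t powr (p - 2 - 1) = t powr (p - 1) / t\<^sup>2"
        using t powr_diff[of t "p - 1" 1] powr_diff[of t "p - 1" 2] by (simp_all add: algebra_simps)
      have "?f p (y + h) t - ?f p y t + h * ?f (p - 1) y t
             = t powr (p - 1) * exp (- t - y / t) * (exp v - 1 - v)"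
        using t unfolding p1 v_def
        by (simp add: algebra_simps add_divide_distrib diff_divide_distrib flip: exp_add)
      hence "norm (?f p (y + h) t - ?f p y t + h * ?f (p - 1) y t)
             = t powr (p - 1) * exp (- t - y / t) * \<bar>exp v - 1 - v\<bar>"
        by (simp add: abs_mult)
      also have "\<dots> \<le> t powr (p - 1) * exp (- t - y / t) * (v\<^sup>2 * exp \<bar>v\<bar>)"
        by (intro mult_left_mono abs_exp_diff_linear_le) auto
      also have "\<dots> = t powr (p - 1) * v\<^sup>2 * exp (- t - y / t + \<bar>v\<bar>)"
        by (simp add: exp_add)
      also have "\<dots> \<le> t powr (p - 1) * v\<^sup>2 * exp (- t - y / 2 / t)"
      proof -
        have "\<bar>v\<bar> = \<bar>h\<bar> / t" using t by (simp add: v_def)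
        also have "\<dots> \<le> y / 2 / t" using h t by (intro divide_right_mono) auto
        finally have "- t - y / t + \<bar>v\<bar> \<le> - t - y / 2 / t" by (simp add: field_simps)
        thus ?thesis by (intro mult_left_mono) auto
      qed
      also have "\<dots> = h\<^sup>2 * ?f (p - 2) (y / 2) t"
        unfolding p1 v_def by (simp add: power_divide)
      finally show ?thesis .
    qed
    ultimately have "norm (macdonald_integral p (y + h) - macdonald_integral p y + h * macdonald_integral (p - 1) y) \<le> h\<^sup>2 * C"
      by (rule has_integral_norm_le)
    thus ?thesis by simp
  qed
  have "((\<lambda>h. (macdonald_integral p (y + h) - macdonald_integral p y) / h - (- macdonald_integral (p - 1) y)) \<longlongrightarrow> 0) (at 0)"
  proof (rule Lim_null_comparison)
    show "((\<lambda>h. C * \<bar>h\<bar>) \<longlongrightarrow> 0) (at 0)"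
      by (auto intro!: tendsto_eq_intros)
    have "norm ((macdonald_integral p (y + h) - macdonald_integral p y) / h - (- macdonald_integral (p - 1) y)) \<le> C * \<bar>h\<bar>"
      if "h \<noteq> 0" "\<bar>h\<bar> < y / 2" for h
    proof -
      have "(macdonald_integral p (y + h) - macdonald_integral p y) / h - (- macdonald_integral (p - 1) y)
          = (macdonald_integral p (y + h) - macdonald_integral p y + h * macdonald_integral (p - 1) y) / h"
        using that by (simp add: field_simps)
      thus ?thesis
        using est[OF that(2)] that by (simp add: abs_divide divide_le_eq power2_eq_square mult_ac flip: abs_mult)
    qed
    moreover have "\<forall>\<^sub>F h in at 0. h \<noteq> 0 \<and> \<bar>h\<bar> < y / 2"
      unfolding eventually_at using assms by (intro exI[of _ "y / 2"]) auto
    ultimately show "\<forall>\<^sub>F h in at 0. norm ((macdonald_integral p (y + h) - macdonald_integral p y) / h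
        - (- macdonald_integral (p - 1) y)) \<le> C * \<bar>h\<bar>"
      by (auto elim: eventually_mono)
  qed
  thus ?thesis
    unfolding DERIV_def by (rule LIM_zero_cancel)
qed

text \<open>The substitution \<open>t = y / s\<close> swaps the two terms of the exponent. It turns
  the order \<open>p - 1\<close> produced by differentiation into \<open>1 - p\<close>, which closes
  the system for orders between 0 and 1.\<close>

lemma macdonald_reflect:
  assumes "y > 0"
  shows "macdonald_integral (- p) y = y powr (- p) * macdonald_integral p y"
proof -
  let ?f = "\<lambda>p t. t powr (p - 1) * exp (- t - y / t) :: real"
  have img: "(\<lambda>s. y / s) ` {0<..} = {0<..}"
    using assms by (auto intro!: image_eqI[where x = "y / s" for s])
  have "inj_on (\<lambda>s. y / s) {0<..}" using assms by (auto simp: inj_on_def)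
  moreover have "((\<lambda>s. y / s) has_field_derivative - y / s\<^sup>2) (at s within {0<..})" if "s \<in> {0<..}" for s
    using that by (auto intro!: derivative_eq_intros simp: power2_eq_square)
  moreover have "?f (- p) absolutely_integrable_on (\<lambda>s. y / s) ` {0<..} \<and>
      integral ((\<lambda>s. y / s) ` {0<..}) (?f (- p)) = macdonald_integral (- p) y"
    unfolding img using macdonald_absolutely_integrable[OF assms] by (simp add: macdonald_integral_def)
  ultimately have "integral {0<..} (\<lambda>s. \<bar>- y / s\<^sup>2\<bar> * ?f (- p) (y / s)) = macdonald_integral (- p) y"
    using has_absolute_integral_change_of_variables_1'[of "{0<..}" "\<lambda>s. y / s" "\<lambda>s. - y / s\<^sup>2" "?f (- p)"]
    by (auto simp del: greaterThan_iff)
  also have "integral {0<..} (\<lambda>s. \<bar>- y / s\<^sup>2\<bar> * ?f (- p) (y / s)) = integral {0<..} (\<lambda>s. y powr (- p) * ?f p s)"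
  proof (rule integral_cong)
    fix s :: real assume "s \<in> {0<..}"
    hence s: "s > 0" by simp
    have "(y / s) powr (- p - 1) = y powr (- p) / y * (s powr (p - 1) * s\<^sup>2)"
      using s assms powr_diff[of y "- p" 1] powr_add[of s "p - 1" 2]
      by (simp add: powr_divide divide_powr_uminus algebra_simps flip: powr_minus_divide)
    thus "\<bar>- y / s\<^sup>2\<bar> * ?f (- p) (y / s) = y powr (- p) * ?f p s"
      using s assms by (simp add: algebra_simps)
  qed
  also have "\<dots> = y powr (- p) * macdonald_integral p y"
    unfolding macdonald_integral_def by simp
  finally show ?thesis ..
qed

text \<open>For \<open>u = y / t\<close> one has \<open>1 - exp (- u) \<le> u powr (p / 2)\<close>:
  linear for small \<open>u\<close>, trivial for large \<open>u\<close>. The exponent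
  \<open>p / 2\<close> gives a vanishing power of \<open>y\<close> and still leaves a convergent
  Gamma integral of order \<open>p / 2\<close>.\<close>

lemma macdonald_tendsto_Gamma:
  assumes p: "0 < p" "p < 1"
  shows "(macdonald_integral p \<longlongrightarrow> Gamma p) (at_right 0)"
proof (rule LIM_zero_cancel, rule Lim_null_comparison)
  show "((\<lambda>y. y powr (p / 2) * Gamma (p / 2)) \<longlongrightarrow> 0) (at_right 0)"
    using p by (intro tendsto_mult_left_zero tendsto_zero_powrI[where b = "p/2"] tendsto_intros)
       (auto simp: eventually_at_filter)
  have "norm (macdonald_integral p y - Gamma p) \<le> y powr (p / 2) * Gamma (p / 2)" if y: "y > 0" for y
  proof (rule has_integral_norm_le)
    show "((\<lambda>t. t powr (p - 1) * exp (- t - y / t) - t powr (p - 1) * exp (- t)) has_integral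
        macdonald_integral p y - Gamma p) {0<..}"
      by (intro has_integral_diff macdonald_has_integral has_integral_Gamma_real y p)
    show "((\<lambda>t. y powr (p / 2) * (t powr (p / 2 - 1) * exp (- t))) has_integral
        y powr (p / 2) * Gamma (p / 2)) {0<..}"
      using p by (intro has_integral_mult_right has_integral_Gamma_real) auto
    fix t :: real assume "t \<in> {0<..}"
    hence t: "t > 0" by simp
    have "1 - exp (- (y / t)) \<le> (y / t) powr (p / 2)"
    proof (cases "y / t \<le> 1")
      case True
      have "1 - exp (- (y / t)) \<le> (y / t) powr 1"
        using exp_ge_add_one_self[of "- (y / t)"] t y by simp
      also have "\<dots> \<le> (y / t) powr (p / 2)"
        using True t y p by (intro powr_mono') auto
      finally show ?thesis .
    next
      case False
      hence "1 \<le> (y / t) powr (p / 2)" using p by (intro ge_one_powr_ge_zero) auto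
      thus ?thesis using exp_gt_zero[of "- (y / t)"] by linarith
    qed
    hence "t powr (p - 1) * exp (- t) * (1 - exp (- (y / t))) \<le> t powr (p - 1) * exp (- t) * (y / t) powr (p / 2)"
      by (intro mult_left_mono) auto
    also have "(y / t) powr (p / 2) = y powr (p / 2) * t powr (- (p / 2))"
      using t y by (simp add: powr_divide powr_minus_divide)
    also have "t powr (p - 1) * exp (- t) * (y powr (p / 2) * t powr (- (p / 2)))
        = y powr (p / 2) * (t powr (p - 1 + - (p / 2)) * exp (- t))"
      unfolding powr_add by simp
    also have "p - 1 + - (p / 2) = p / 2 - 1" by simp
    finally have "t powr (p - 1) * exp (- t) * (1 - exp (- (y / t))) \<le> y powr (p / 2) * (t powr (p / 2 - 1) * exp (- t))" .
    moreover have "t powr (p - 1) * exp (- t - y / t) - t powr (p - 1) * exp (- t)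
        = - (t powr (p - 1) * exp (- t) * (1 - exp (- (y / t))))"
      by (simp add: algebra_simps flip: exp_add)
    moreover have "0 \<le> t powr (p - 1) * exp (- t) * (1 - exp (- (y / t)))"
      using t y by (intro mult_nonneg_nonneg) auto
    ultimately show "norm (t powr (p - 1) * exp (- t - y / t) - t powr (p - 1) * exp (- t))
        \<le> y powr (p / 2) * (t powr (p / 2 - 1) * exp (- t))"
      by (simp only: real_norm_def abs_minus_cancel abs_of_nonneg)
  qed
  thus "\<forall>\<^sub>F y in at_right 0. norm (macdonald_integral p y - Gamma p) \<le> y powr (p / 2) * Gamma (p / 2)"
    by (auto simp: eventually_at_filter)
qed

text \<open>A squeeze from pointwise bounds on \<open>t powr (p - 1)\<close>: below by
  \<open>1 - (1 - p) * t\<close>, from \<open>ln t \<le> t\<close> and the tangent of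
  \<open>exp\<close>; above by \<open>p + (1 - p) / t\<close>, from convexity of
  \<open>exp\<close>.\<close>

lemma macdonald_tendsto_1:
  assumes y: "y > 0"
  shows "((\<lambda>p. macdonald_integral p y) \<longlongrightarrow> macdonald_integral 1 y) (at_left 1)"
proof (rule tendsto_sandwich)
  let ?f = "\<lambda>p t. t powr (p - 1) * exp (- t - y / t) :: real"
  have lower: "macdonald_integral 1 y - (1 - p) * macdonald_integral 2 y \<le> macdonald_integral p y" if p: "p < 1" for p
  proof (rule has_integral_le)
    show "((\<lambda>t. ?f 1 t - (1 - p) * ?f 2 t) has_integral
             macdonald_integral 1 y - (1 - p) * macdonald_integral 2 y) {0<..}"
      by (intro has_integral_diff has_integral_mult_right macdonald_has_integral y)
    show "(?f p has_integral macdonald_integral p y) {0<..}"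
      by (rule macdonald_has_integral[OF y])
    fix t :: real assume "t \<in> {0<..}"
    hence t: "t > 0" by simp
    have "(1 - p) * ln t \<le> (1 - p) * t"
      using p t ln_le_minus_one[of t] by (intro mult_left_mono) auto
    hence "1 - (1 - p) * t \<le> 1 + (p - 1) * ln t"
      by (simp add: algebra_simps)
    also have "\<dots> \<le> t powr (p - 1)"
      using t exp_ge_add_one_self[of "(p - 1) * ln t"] by (simp add: powr_def)
    finally have "(1 - (1 - p) * t) * exp (- t - y / t) \<le> ?f p t"
      by (intro mult_right_mono) auto
    thus "?f 1 t - (1 - p) * ?f 2 t \<le> ?f p t"
      using t by (simp add: algebra_simps)
  qed
  have upper: "macdonald_integral p y \<le> p * macdonald_integral 1 y + (1 - p) * macdonald_integral 0 y"
    if p: "0 < p" "p < 1" for p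
  proof (rule has_integral_le)
    show "((\<lambda>t. p * ?f 1 t + (1 - p) * ?f 0 t) has_integral
             p * macdonald_integral 1 y + (1 - p) * macdonald_integral 0 y) {0<..}"
      by (intro has_integral_add has_integral_mult_right macdonald_has_integral y)
    show "(?f p has_integral macdonald_integral p y) {0<..}"
      by (rule macdonald_has_integral[OF y])
    fix t :: real assume "t \<in> {0<..}"
    hence t: "t > 0" by simp
    have "convex_on UNIV (exp :: real \<Rightarrow> real)" by (rule exp_convex)
    from convex_onD[OF this, of "1 - p" 0 "- ln t"] p
    have "t powr (p - 1) \<le> p + (1 - p) * exp (- ln t)"
      using t by (simp add: powr_def algebra_simps)
    also have "exp (- ln t) = t powr (- 1)" using t by (simp add: powr_def)
    finally have "?f p t \<le> (p + (1 - p) * t powr (- 1)) * exp (- t - y / t)"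
      by (intro mult_right_mono) auto
    thus "?f p t \<le> p * ?f 1 t + (1 - p) * ?f 0 t"
      using t by (simp add: algebra_simps)
  qed
  show "\<forall>\<^sub>F p in at_left 1. macdonald_integral 1 y - (1 - p) * macdonald_integral 2 y \<le> macdonald_integral p y"
    using lower by (auto simp: eventually_at_filter)
  show "\<forall>\<^sub>F p in at_left 1. macdonald_integral p y \<le> p * macdonald_integral 1 y + (1 - p) * macdonald_integral 0 y"
    using eventually_at_left_real[of 0 1] upper by (auto elim: eventually_mono)
  show "((\<lambda>p. macdonald_integral 1 y - (1 - p) * macdonald_integral 2 y) \<longlongrightarrow> macdonald_integral 1 y) (at_left 1)"
    by (auto intro!: tendsto_eq_intros)
  show "((\<lambda>p. p * macdonald_integral 1 y + (1 - p) * macdonald_integral 0 y) \<longlongrightarrow> macdonald_integral 1 y) (at_left 1)"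
    by (auto intro!: tendsto_eq_intros)
qed

text \<open>Gronwall from the singular point 0. The coefficients blow up there but are integrable,
  with primitive sum \<open>\<Phi>\<close>, because both \<open>p\<close> and \<open>1 - p\<close>
  are positive. With the factor \<open>exp (- \<Phi>)\<close> the derivative of the energy is
  \<open>- \<Phi>' |f + g|^2 exp (- \<Phi>)\<close>, so the energy decreases from its limit
  0.\<close>

lemma coupled_system_unique:
  fixes f g :: "real \<Rightarrow> complex"
  assumes p: "0 < p" "p < 1"
    and f': "\<And>y. y > 0 \<Longrightarrow> (f has_vector_derivative - of_real (y powr (p - 1)) * g y) (at y)"
    and g': "\<And>y. y > 0 \<Longrightarrow> (g has_vector_derivative - of_real (y powr (- p)) * f y) (at y)"
    and f0: "(f \<longlongrightarrow> 0) (at_right 0)" and g0: "(g \<longlongrightarrow> 0) (at_right 0)"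
    and y: "y > 0"
  shows "f y = 0"
proof -
  define \<Phi> where "\<Phi> y = y powr p / p + y powr (1 - p) / (1 - p)" for y
  define E where "E y = ((norm (f y))\<^sup>2 + (norm (g y))\<^sup>2) * exp (- \<Phi> y)" for y
  define E' where "E' y = (- (y powr (p - 1) + y powr (- p)) *
      (2 * (f y \<bullet> g y) + (norm (f y))\<^sup>2 + (norm (g y))\<^sup>2)) * exp (- \<Phi> y)" for y
  have \<Phi>': "(\<Phi> has_real_derivative y powr (p - 1) + y powr (- p)) (at y)" if "y > 0" for y
  proof -
    have "(\<Phi> has_real_derivative
            p * y powr (p - 1) / p + (1 - p) * y powr (1 - p - 1) / (1 - p)) (at y)"
      unfolding \<Phi>_def by (intro DERIV_add DERIV_cdivide has_real_derivative_powr that)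
    thus ?thesis using p by simp
  qed
  have E': "(E has_real_derivative E' y) (at y)" if "y > 0" for y
  proof -
    have "(E has_real_derivative (2 * (f y \<bullet> (- of_real (y powr (p - 1)) * g y))
              + 2 * (g y \<bullet> (- of_real (y powr (- p)) * f y))) * exp (- \<Phi> y)
            + exp (- \<Phi> y) * (- (y powr (p - 1) + y powr (- p))) * ((norm (f y))\<^sup>2 + (norm (g y))\<^sup>2)) (at y)"
      unfolding E_def
      by (intro DERIV_mult DERIV_add has_real_derivative_norm_power2 f' g' that
            DERIV_fun_exp DERIV_minus \<Phi>')
    moreover have "f y \<bullet> (- of_real (y powr (p - 1)) * g y) = - (y powr (p - 1) * (f y \<bullet> g y))"
        "g y \<bullet> (- of_real (y powr (- p)) * f y) = - (y powr (- p) * (f y \<bullet> g y))"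
      by (simp_all add: inner_complex_def algebra_simps)
    ultimately show ?thesis
      unfolding E'_def by (elim DERIV_cong) (simp only:, simp add: algebra_simps)
  qed
  have "E' y \<le> 0" if "y > 0" for y
  proof -
    have "2 * (f y \<bullet> g y) + (norm (f y))\<^sup>2 + (norm (g y))\<^sup>2 = (norm (f y + g y))\<^sup>2"
      by (simp add: power2_norm_eq_inner inner_add_left inner_add_right inner_commute)
    moreover have "0 \<le> (y powr (p - 1) + y powr (- p)) * (norm (f y + g y))\<^sup>2 * exp (- \<Phi> y)"
      by (intro mult_nonneg_nonneg add_nonneg_nonneg) auto
    ultimately show ?thesis
      unfolding E'_def by (simp only: mult_minus_left neg_le_0_iff_le)
  qed
  note E'_le = this
  have mono: "E y \<le> E s" if "0 < s" "s \<le> y" for s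
  proof (rule DERIV_nonpos_imp_nonincreasing[OF that(2)])
    fix t assume "s \<le> t"
    with that(1) have "t > 0" by simp
    thus "\<exists>D. (E has_real_derivative D) (at t) \<and> D \<le> 0" using E' E'_le by blast
  qed
  have "((\<lambda>y. ((norm (f y))\<^sup>2 + (norm (g y))\<^sup>2) * exp (- \<Phi> y)) \<longlongrightarrow> (0\<^sup>2 + 0\<^sup>2) * exp (- (0 / p + 0 / (1 - p)))) (at_right 0)"
  proof -
    have "((\<lambda>y. y powr a) \<longlongrightarrow> 0) (at_right 0)" if "a > 0" for a :: real
      using that by (intro tendsto_zero_powrI[where b = a] tendsto_intros) (auto simp: eventually_at_filter)
    from this[of p] this[of "1 - p"] p show ?thesis
      unfolding \<Phi>_def by (intro tendsto_intros tendsto_norm_zero f0 g0) auto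
  qed
  hence "(E \<longlongrightarrow> 0) (at_right 0)" unfolding E_def by simp
  moreover have "\<forall>\<^sub>F s in at_right 0. E y \<le> E s"
    using eventually_at_right_real[OF y] by (rule eventually_mono) (use mono in auto)
  ultimately have "E y \<le> 0"
    by (intro tendsto_lowerbound[of E 0 "at_right 0"]) auto
  hence "(norm (f y))\<^sup>2 + (norm (g y))\<^sup>2 \<le> 0"
    unfolding E_def by (simp add: mult_le_0_iff)
  thus ?thesis by (simp add: sum_power2_le_zero_iff)
qed

text \<open>The candidate closed form of \<open>macdonald_integral p y\<close>: with
  \<open>y = (x / 2)^2\<close> the bracket is the difference of \<open>bessel_I\<close> at orders
  \<open>- p\<close> and \<open>p\<close>, after pulling out
  \<open>(x / 2) powr (- p)\<close>.\<close>

definition macdonald_series :: "real \<Rightarrow> real \<Rightarrow> complex" where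
  "macdonald_series p y = of_real (pi / sin (pi * p)) *
     (bessel_series (- of_real p) (of_real y) -
      of_real (y powr p) * bessel_series (of_real p) (of_real y))"

text \<open>The recurrence at order \<open>p - 1\<close> collapses the derivative of the second
  summand to \<open>y powr (p - 1)\<close> times the series of order \<open>p - 1\<close>. The two
  summands thereby exchange roles under \<open>p \<mapsto> 1 - p\<close>, with a sign, and the sine
  is symmetric under this exchange.\<close>

lemma has_vector_derivative_macdonald_series:
  assumes p: "0 < p" "p < 1" and y: "y > 0"
  shows "(macdonald_series p has_vector_derivative
           - of_real (y powr (p - 1)) * macdonald_series (1 - p) y) (at y)"
proof -
  define S where "S \<nu> = bessel_series \<nu> (of_real y)" for \<nu>
  have S': "((\<lambda>y. bessel_series \<nu> (of_real y)) has_vector_derivative S (\<nu> + 1)) (at y)" for \<nu>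
    unfolding S_def
    using has_vector_derivative_bessel_series_comp[of "\<lambda>z. z" 1 y \<nu> UNIV] by (simp add: DERIV_ident)
  have "((\<lambda>y. y powr p) has_real_derivative p * y powr (p - 1)) (at y)"
    using y by (auto intro!: derivative_eq_intros)
  hence P': "((\<lambda>y. of_real (y powr p)) has_vector_derivative (of_real (p * y powr (p - 1)) :: complex)) (at y)"
    by (intro has_vector_derivative_of_real) (simp add: has_real_derivative_iff_has_vector_derivative)
  have "(macdonald_series p has_vector_derivative of_real (pi / sin (pi * p)) *
          (S (- of_real p + 1) - (of_real (y powr p) * S (of_real p + 1) +
             of_real (p * y powr (p - 1)) * S (of_real p)))) (at y)"
    unfolding macdonald_series_def S_def[of "of_real p"]
    by (intro has_vector_derivative_mult_right has_vector_derivative_diff has_vector_derivative_mult S' P')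
  moreover have "S (of_real p - 1) = of_real p * S (of_real p) + of_real y * S (of_real p + 1)"
    using bessel_series_recurrence[of "of_real p - 1" "of_real y"] unfolding S_def
    by (simp add: algebra_simps)
  moreover have "y powr p = y powr (p - 1) * y"
    using y powr_mult_base[of y "p - 1"] by (simp add: mult.commute)
  moreover have "y powr (p - 1) * y powr (1 - p) = 1"
    using y by (simp flip: powr_add)
  hence "of_real (y powr (p - 1)) * of_real (y powr (1 - p)) = (1 :: complex)"
    by (metis of_real_1 of_real_mult)
  moreover have "sin (pi * (1 - p)) = sin (pi * p)"
    using sin_pi_minus[of "pi * p"] by (simp add: algebra_simps)
  ultimately show ?thesis
    unfolding macdonald_series_def S_def[symmetric]
    by (elim has_vector_derivative_eq_rhs)
       (simp add: S_def[symmetric] algebra_simps)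
qed

text \<open>Only the value \<open>rGamma (1 - p)\<close> of the first series survives at 0; Euler's
  reflection formula converts it, with the sine factor, into \<open>Gamma p\<close>.\<close>

lemma macdonald_series_tendsto_Gamma:
  assumes p: "0 < p" "p < 1"
  shows "(macdonald_series p \<longlongrightarrow> of_real (Gamma p)) (at_right 0)"
proof -
  have "((\<lambda>y. bessel_series \<nu> (of_real y)) \<longlongrightarrow> rGamma (\<nu> + 1)) (at_right 0)" for \<nu>
  proof -
    have "continuous_on UNIV (\<lambda>y::real. bessel_series \<nu> (of_real y))"
      by (intro continuous_intros)
    from this[unfolded continuous_on_def, rule_format, of 0]
    have "((\<lambda>y::real. bessel_series \<nu> (of_real y)) \<longlongrightarrow> bessel_series \<nu> (of_real 0)) (at 0)"
      by simp
    thus ?thesis by (auto simp: bessel_series_0_right intro: filterlim_mono at_le)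
  qed
  moreover have "((\<lambda>y::real. y powr p) \<longlongrightarrow> 0) (at_right 0)"
    using p by (intro tendsto_zero_powrI[where b = p] tendsto_intros) (auto simp: eventually_at_filter)
  ultimately have "(macdonald_series p \<longlongrightarrow> of_real (pi / sin (pi * p)) *
      (rGamma (- of_real p + 1) - of_real 0 * rGamma (of_real p + 1))) (at_right 0)"
    unfolding macdonald_series_def by (intro tendsto_intros)
  also have "of_real (pi / sin (pi * p)) * (rGamma (- of_real p + 1) - of_real 0 * rGamma (of_real p + 1))
      = (of_real (Gamma p) :: complex)"
  proof -
    have "Gamma p * Gamma (1 - p) = pi / sin (pi * p)"
    proof -
      have "complex_of_real (Gamma p * Gamma (1 - p)) = of_real (pi / sin (pi * p))"
        using Gamma_reflection_complex[of "of_real p"] Gamma_complex_of_real[of "1 - p"]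
        by (simp add: Gamma_complex_of_real flip: sin_of_real)
      thus ?thesis by (simp only: of_real_eq_iff)
    qed
    moreover have "Gamma (1 - p) \<noteq> 0" using p by (intro less_imp_neq[symmetric] Gamma_real_pos) simp
    ultimately have "pi / sin (pi * p) * rGamma (1 - p) = Gamma p"
      by (simp add: rGamma_inverse_Gamma flip: \<open>Gamma p * Gamma (1 - p) = pi / sin (pi * p)\<close>)
    moreover have "rGamma (- of_real p + 1 :: complex) = of_real (rGamma (1 - p))"
      by (simp add: rGamma_complex_of_real[symmetric])
    ultimately show ?thesis
      by (metis of_real_0 mult_zero_left diff_zero of_real_mult)
  qed
  finally show ?thesis .
qed

lemma macdonald_integral_eq_series:
  assumes p: "0 < p" "p < 1" and y: "y > 0"
  shows "of_real (macdonald_integral p y) = macdonald_series p y"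
proof -
  \<comment> \<open>The order stays a parameter because \<open>d p\<close> and
    \<open>d (1 - p)\<close> together form the pair for the uniqueness lemma.\<close>
  define d where "d p y = of_real (macdonald_integral p y) - macdonald_series p y" for p y
  have d': "(d p has_vector_derivative - of_real (y powr (p - 1)) * d (1 - p) y) (at y)"
    if "0 < p" "p < 1" "y > 0" for p y
  proof -
    have "macdonald_integral (p - 1) y = y powr (p - 1) * macdonald_integral (1 - p) y"
      using macdonald_reflect[OF that(3), of "1 - p"] by simp
    hence "((\<lambda>y. of_real (macdonald_integral p y)) has_vector_derivative
             (of_real (- (y powr (p - 1) * macdonald_integral (1 - p) y)) :: complex)) (at y)"
      using has_real_derivative_macdonald[OF that(3), of p]
      by (intro has_vector_derivative_of_real) (simp add: has_real_derivative_iff_has_vector_derivative)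
    from has_vector_derivative_diff[OF this has_vector_derivative_macdonald_series[OF that]]
    show ?thesis
      unfolding d_def by (elim has_vector_derivative_eq_rhs) (simp add: algebra_simps)
  qed
  have d0: "(d p \<longlongrightarrow> 0) (at_right 0)" if "0 < p" "p < 1" for p
  proof -
    have "(d p \<longlongrightarrow> of_real (Gamma p) - of_real (Gamma p)) (at_right 0)"
      unfolding d_def
      by (intro tendsto_intros macdonald_tendsto_Gamma macdonald_series_tendsto_Gamma that)
    thus ?thesis by simp
  qed
  have "d p y = 0"
  proof (rule coupled_system_unique[OF p])
    show "(d p has_vector_derivative - of_real (y powr (p - 1)) * d (1 - p) y) (at y)" if "y > 0" for y
      using d'[of p y] p that by simp
    show "(d (1 - p) has_vector_derivative - of_real (y powr (- p)) * d p y) (at y)" if "y > 0" for y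
      using d'[of "1 - p" y] p that by simp
  qed (use d0 p y in auto)
  thus ?thesis by (simp add: d_def)
qed

lemma bessel_K_nonint_eq_macdonald_integral:
  assumes p: "0 < p" "p < 1" and x: "x > 0"
  shows "bessel_K_nonint (of_real p) (of_real x) =
           of_real ((x / 2) powr (- p) / 2 * macdonald_integral p ((x / 2)\<^sup>2))"
proof -
  have e: "exp (of_real q * Ln (of_real x / 2)) = (of_real ((x / 2) powr q) :: complex)" for q
  proof -
    have "Ln (of_real x / 2) = of_real (ln (x / 2))"
      using x Ln_of_real[of "x / 2"] by simp
    thus ?thesis using x by (simp add: powr_def exp_of_real[symmetric])
  qed
  \<comment> \<open>This brings both orders to the common factor \<open>(x / 2) powr (- p)\<close>,
    leaving the bracket of \<open>macdonald_series\<close>.\<close>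
  have "(x / 2) powr p = (x / 2) powr (- p) * ((x / 2)\<^sup>2) powr p"
  proof -
    have "((x / 2)\<^sup>2) powr p = (x / 2) powr (2 * p)"
      using x by (simp add: powr_powr flip: powr_numeral)
    thus ?thesis by (simp flip: powr_add)
  qed
  hence "bessel_I (- of_real p) (of_real x) - bessel_I (of_real p) (of_real x) =
     of_real ((x / 2) powr (- p)) * (bessel_series (- of_real p) (of_real ((x / 2)\<^sup>2)) -
      of_real (((x / 2)\<^sup>2) powr p) * bessel_series (of_real p) (of_real ((x / 2)\<^sup>2)))"
    using x e[of p] e[of "- p"] by (simp add: bessel_I_eq algebra_simps)
  moreover have "sin (of_real p * of_real pi) = (of_real (sin (pi * p)) :: complex)"
    by (simp add: sin_of_real[symmetric] mult.commute)
  moreover have "of_real (macdonald_integral p ((x / 2)\<^sup>2)) = macdonald_series p ((x / 2)\<^sup>2)"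
    using x by (intro macdonald_integral_eq_series p) simp
  ultimately show ?thesis
    unfolding bessel_K_nonint_def of_real_mult macdonald_series_def by simp
qed

lemma bessel_K_1_eq_macdonald_integral:
  assumes x: "x > 0"
  shows "of_real x / 2 * bessel_K 1 (of_real x) = of_real (macdonald_integral 1 ((x / 2)\<^sup>2) / 2)"
proof -
  \<comment> \<open>The integral formula is available for real \<open>p\<close> below 1 only; since
    the full complex limit in the order exists, it may be evaluated along this one-sided
    approach.\<close>
  have "filterlim (\<lambda>p. of_real p :: complex) (at 1) (at_left 1)"
    unfolding filterlim_at by (auto intro!: tendsto_eq_intros simp: eventually_at_filter)
  from filterlim_compose[OF bessel_K_nonint_tendsto this] x
  have "((\<lambda>p. bessel_K_nonint (of_real p) (of_real x)) \<longlongrightarrow> bessel_K 1 (of_real x)) (at_left 1)"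
    by simp
  moreover have "\<forall>\<^sub>F p in at_left 1. bessel_K_nonint (of_real p) (of_real x) =
      of_real ((x / 2) powr (- p) / 2 * macdonald_integral p ((x / 2)\<^sup>2))"
  proof (rule eventually_mono)
    show "\<forall>\<^sub>F p in at_left 1. p \<in> {0<..<1::real}"
      by (rule eventually_at_left_real) simp
  qed (intro bessel_K_nonint_eq_macdonald_integral x; simp)
  ultimately have 1: "((\<lambda>p. of_real ((x / 2) powr (- p) / 2 * macdonald_integral p ((x / 2)\<^sup>2)))
      \<longlongrightarrow> bessel_K 1 (of_real x)) (at_left 1)"
    by (rule Lim_transform_eventually)
  have 2: "((\<lambda>p. of_real ((x / 2) powr (- p) / 2 * macdonald_integral p ((x / 2)\<^sup>2)) :: complex)
      \<longlongrightarrow> of_real ((x / 2) powr (- 1) / 2 * macdonald_integral 1 ((x / 2)\<^sup>2))) (at_left 1)"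
    using x by (intro tendsto_intros macdonald_tendsto_1) auto
  have "bessel_K 1 (of_real x) = of_real ((x / 2) powr (- 1) / 2 * macdonald_integral 1 ((x / 2)\<^sup>2))"
    using tendsto_unique[OF _ 1 2] by simp
  thus ?thesis using x by (simp add: powr_minus_divide)
qed

subsection \<open>Evaluation of the integral on the positive axis\<close>

lemma has_bochner_integral_gaussian_moment:
  assumes s: "s > (0::real)"
  shows "has_bochner_integral lborel (\<lambda>c::real. indicator {0..} c * (exp (- s * c\<^sup>2) * c ^ (2 * k + 1)))
           (fact k / (2 * s ^ (k + 1)))"
proof -
  define r where "r = sqrt s"
  have r: "r > 0" "r ^ 2 = s" using s by (simp_all add: r_def)
  have "has_bochner_integral lborel (\<lambda>c::real. indicator {0..} (0 + r * c) *\<^sub>R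
          (exp (- (0 + r * c)\<^sup>2) * (0 + r * c) ^ (2 * k + 1))) ((fact k / 2) /\<^sub>R \<bar>r\<bar>)"
    using r by (intro lborel_has_bochner_integral_real_affine_iff[THEN iffD1] gaussian_moment_odd_pos) auto
  from has_bochner_integral_mult_right[OF this, of "1 / r ^ (2 * k + 1)"]
  have "has_bochner_integral lborel (\<lambda>c::real. 1 / r ^ (2 * k + 1) * (indicator {0..} (0 + r * c) *\<^sub>R
          (exp (- (0 + r * c)\<^sup>2) * (0 + r * c) ^ (2 * k + 1)))) (1 / r ^ (2 * k + 1) * ((fact k / 2) /\<^sub>R \<bar>r\<bar>))"
    by simp
  also have "(\<lambda>c::real. 1 / r ^ (2 * k + 1) * (indicator {0..} (0 + r * c) *\<^sub>R
          (exp (- (0 + r * c)\<^sup>2) * (0 + r * c) ^ (2 * k + 1))))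
     = (\<lambda>c. indicator {0..} c * (exp (- s * c\<^sup>2) * c ^ (2 * k + 1)))"
    using r by (auto simp: fun_eq_iff indicator_def power_mult_distrib zero_le_mult_iff)
  also have "1 / r ^ (2 * k + 1) * ((fact k / 2) /\<^sub>R \<bar>r\<bar>) = fact k / (2 * s ^ (k + 1))"
  proof -
    have "r ^ (2 * k + 1) * r = s ^ (k + 1)"
      unfolding r(2)[symmetric] power_mult[symmetric] by simp
    from this[symmetric] show ?thesis using r(1) by (simp only:) (simp add: field_simps)
  qed
  finally show ?thesis .
qed

text \<open>Termwise integration of the series of \<open>J_0 (c x)\<close>: the \<open>k\<close>-th
  Gaussian moment cancels one of the two factorials in \<open>a k\<close>, leaving an exponential
  series. With absolute values the same computation gives the exponential series at
  \<open>x^2 / (4 s)\<close>, which justifies the interchange.\<close>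

lemma has_bochner_integral_gaussian_bessel:
  assumes s: "s > (0::real)"
  shows "has_bochner_integral lborel
           (\<lambda>c::real. of_real (indicator {0..} c * (exp (- s * c\<^sup>2) * c)) *
              bessel_series 0 (- (of_real (c * x) / 2)\<^sup>2))
           (of_real (exp (- x\<^sup>2 / (4 * s)) / (2 * s)) :: complex)"
proof -
  define a where "a k = (- (x\<^sup>2 / 4)) ^ k / (fact k * fact k)" for k :: nat
  define f where "f k c = a k * (indicator {0..} c * (exp (- s * c\<^sup>2) * c ^ (2 * k + 1)))" for k c
  define F where "F k c = (of_real (f k c) :: complex)" for k c
  have bint: "has_bochner_integral lborel (F k) (of_real (a k * (fact k / (2 * s ^ (k + 1)))))" for k
    unfolding F_def f_def
    by (intro has_bochner_integral_of_real has_bochner_integral_mult_right has_bochner_integral_gaussian_moment s)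
  have nint: "(LINT c|lborel. norm (F k c)) = \<bar>a k\<bar> * (fact k / (2 * s ^ (k + 1)))" for k
  proof -
    have "(\<lambda>c. norm (F k c)) = (\<lambda>c. \<bar>a k\<bar> * (indicator {0..} c * (exp (- s * c\<^sup>2) * c ^ (2 * k + 1))))"
    proof
      fix c
      have "norm (F k c) = \<bar>f k c\<bar>" by (simp only: F_def norm_of_real)
      also have "\<dots> = \<bar>a k\<bar> * (indicator {0..} c * (exp (- s * c\<^sup>2) * c ^ (2 * k + 1)))"
        by (cases "c \<ge> 0") (simp_all add: f_def abs_mult)
      finally show "norm (F k c) = \<bar>a k\<bar> * (indicator {0..} c * (exp (- s * c\<^sup>2) * c ^ (2 * k + 1)))" .
    qed
    thus ?thesis
      using has_bochner_integral_mult_right[OF has_bochner_integral_gaussian_moment[OF s, of k], of "\<bar>a k\<bar>"]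
      by (simp add: has_bochner_integral_iff)
  qed
  have val: "a k * (fact k / (2 * s ^ (k + 1))) = (- x\<^sup>2 / (4 * s)) ^ k /\<^sub>R fact k * (1 / (2 * s))" for k
  proof -
    have "(- x\<^sup>2 / (4 * s)) ^ k = (- (x\<^sup>2 / 4)) ^ k / s ^ k"
      by (simp flip: power_divide)
    thus ?thesis using s by (simp add: a_def field_simps)
  qed
  have absval: "\<bar>a k\<bar> * (fact k / (2 * s ^ (k + 1))) = (x\<^sup>2 / (4 * s)) ^ k /\<^sub>R fact k * (1 / (2 * s))" for k
  proof -
    have "\<bar>a k * (fact k / (2 * s ^ (k + 1)))\<bar> = \<bar>a k\<bar> * (fact k / (2 * s ^ (k + 1)))"
      using s by (simp add: abs_mult)
    thus ?thesis unfolding val using s by (simp add: abs_mult power_abs)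
  qed
  have sums: "(\<lambda>k. F k c) sums (of_real (indicator {0..} c * (exp (- s * c\<^sup>2) * c)) *
              bessel_series 0 (- (of_real (c * x) / 2)\<^sup>2))"
    and nsum: "summable (\<lambda>k. norm (F k c))" for c
  proof -
    have eq: "F k c = of_real (indicator {0..} c * (exp (- s * c\<^sup>2) * c)) *
        (rGamma (0 + of_nat k + 1) / fact k * (- (of_real (c * x) / 2)\<^sup>2) ^ k)" for k
    proof -
      have "rGamma (of_nat k + 1) = (1 / fact k :: complex)"
        by (simp add: rGamma_inverse_Gamma Gamma_fact[symmetric] add.commute divide_inverse)
      moreover have "(- (of_real (c * x) / 2)\<^sup>2) ^ k = (of_real ((- (x\<^sup>2 / 4)) ^ k * c ^ (2 * k)) :: complex)"
        by (simp add: power_mult flip: power_mult_distrib) (simp add: power_mult_distrib power_divide mult.commute)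
      ultimately show ?thesis
        unfolding F_def f_def a_def by (simp add: mult_ac)
    qed
    show "(\<lambda>k. F k c) sums (of_real (indicator {0..} c * (exp (- s * c\<^sup>2) * c)) *
              bessel_series 0 (- (of_real (c * x) / 2)\<^sup>2))"
      unfolding eq bessel_series_def by (intro sums_mult summable_sums summable_bessel_series)
    obtain C where C: "\<And>k. norm (rGamma (0 + of_nat k + 1) :: complex) \<le> C"
      using rGamma_shift_bounded[of "{0}"] by auto
    have "summable (\<lambda>k. norm (rGamma (0 + of_nat k + 1) / fact k * (- (of_real (c * x) / 2 :: complex)\<^sup>2) ^ k))"
    proof (rule summable_comparison_test')
      show "summable (\<lambda>k. C * (norm (- (of_real (c * x) / 2 :: complex)\<^sup>2) ^ k /\<^sub>R fact k))"
        by (intro summable_mult summable_exp_generic)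
    qed (use norm_bessel_series_term_le[OF C] in \<open>simp only: real_norm_def abs_norm_cancel\<close>)
    thus "summable (\<lambda>k. norm (F k c))"
      unfolding eq norm_mult[of "of_real _"] by (rule summable_mult)
  qed
  have int: "integrable lborel (F k)" for k using bint by (simp add: has_bochner_integral_iff)
  have sm: "summable (\<lambda>k. LINT c|lborel. norm (F k c))"
    unfolding nint absval by (intro summable_mult2 summable_exp_generic)
  have AE: "AE c in lborel. summable (\<lambda>k. norm (F k c))" using nsum by simp
  have lim: "(\<lambda>c. \<Sum>k. F k c) = (\<lambda>c. of_real (indicator {0..} c * (exp (- s * c\<^sup>2) * c)) *
              bessel_series 0 (- (of_real (c * x) / 2)\<^sup>2))"
    using sums by (auto simp: sums_iff)
  have "(\<lambda>k. (- x\<^sup>2 / (4 * s)) ^ k /\<^sub>R fact k * (1 / (2 * s))) sums (exp (- x\<^sup>2 / (4 * s)) * (1 / (2 * s)))"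
    by (intro sums_mult2 exp_converges)
  hence "(\<lambda>k. LINT c|lborel. F k c) sums of_real (exp (- x\<^sup>2 / (4 * s)) * (1 / (2 * s)))"
    using bint unfolding has_bochner_integral_iff by (simp only: val sums_of_real_iff)
  with sums_integral[OF int AE sm] have "(LINT c|lborel. (\<Sum>k. F k c)) = of_real (exp (- x\<^sup>2 / (4 * s)) * (1 / (2 * s)))"
    by (rule sums_unique2)
  moreover have "integrable lborel (\<lambda>c. \<Sum>k. F k c)"
    by (rule integrable_suminf[OF int AE sm])
  ultimately show ?thesis
    unfolding lim by (simp add: has_bochner_integral_iff)
qed

lemma has_bochner_integral_power_exp:
  "has_bochner_integral lborel (\<lambda>t::real. t ^ k * exp (- t) * indicator {0..} t) (fact k)"
proof (rule has_bochner_integral_nn_integral)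
  have "(\<integral>\<^sup>+t. ennreal (t ^ k * exp (- t) * indicator {0..} t) \<partial>lborel)
      = (\<integral>\<^sup>+t. ennreal (t ^ k * exp (- t)) * indicator {0..} t \<partial>lborel)"
    by (intro nn_integral_cong) (auto simp: indicator_def)
  thus "(\<integral>\<^sup>+t. ennreal (t ^ k * exp (- t) * indicator {0..} t) \<partial>lborel) = ennreal (fact k)"
    using nn_intergal_power_times_exp_Ici[of k] by simp
qed (auto simp: indicator_def)

text \<open>With \<open>r = 1 + c^2\<close> this writes the weight \<open>1 / (1 + c^2)^2\<close> as
  a superposition of Gaussians in \<open>c\<close>.\<close>

lemma has_bochner_integral_exp_moment:
  assumes r: "r > (0::real)"
  shows "has_bochner_integral lborel (\<lambda>t. indicator {0..} t * (t * exp (- r * t))) (1 / r\<^sup>2)"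
proof -
  have "has_bochner_integral lborel (\<lambda>t::real. t * exp (- t) * indicator {0..} t) 1"
    using has_bochner_integral_power_exp[of 1] by simp
  hence "has_bochner_integral lborel (\<lambda>t::real. (0 + r * t) * exp (- (0 + r * t)) * indicator {0..} (0 + r * t)) (1 /\<^sub>R \<bar>r\<bar>)"
    using r by (intro lborel_has_bochner_integral_real_affine_iff[THEN iffD1]) auto
  from has_bochner_integral_mult_right[OF this, of "1 / r"]
  have "has_bochner_integral lborel (\<lambda>t::real. 1 / r * ((0 + r * t) * exp (- (0 + r * t)) * indicator {0..} (0 + r * t)))
          (1 / r * (1 /\<^sub>R \<bar>r\<bar>))" by simp
  also have "(\<lambda>t::real. 1 / r * ((0 + r * t) * exp (- (0 + r * t)) * indicator {0..} (0 + r * t)))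
     = (\<lambda>t. indicator {0..} t * (t * exp (- r * t)))"
    using r by (auto simp: fun_eq_iff indicator_def zero_le_mult_iff)
  also have "1 / r * (1 /\<^sub>R \<bar>r\<bar>) = 1 / r\<^sup>2"
    using r by (simp add: power2_eq_square field_simps)
  finally show ?thesis .
qed

text \<open>Fubini for \<open>h\<close>: integrating over \<open>t\<close> first yields the Bessel
  integrand, integrating over \<open>c\<close> first yields half the Macdonald integrand of order
  1.\<close>

lemma has_integral_bessel_integrand:
  assumes x: "x > 0"
  shows "(bessel_integrand (of_real x) has_integral
            of_real (macdonald_integral 1 ((x / 2)\<^sup>2) / 2)) {0..}"
proof -
  define J where "J c = bessel_series 0 (- (of_real (c * x) / 2)\<^sup>2)" for c :: real
  define h :: "real \<times> real \<Rightarrow> complex" where "h = (\<lambda>(t, c). of_real (indicator {0..} t * t * indicator {0..} c * c * exp (- t * (1 + c\<^sup>2))) * J c)"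
  have J_le: "norm (J c) \<le> 1" if "c \<ge> 0" for c
    unfolding J_def using norm_bessel_series_0_le[of "c * x"] that x by simp
  have [measurable]: "J \<in> borel_measurable borel"
    unfolding J_def by (intro borel_measurable_continuous_onI continuous_intros) auto
  have hm: "h \<in> borel_measurable (lborel \<Otimes>\<^sub>M lborel)"
    unfolding h_def by measurable
  \<comment> \<open>At \<open>t = 0\<close> the Gaussian is lost, but the factor \<open>t\<close>
    makes \<open>h\<close> vanish; the open indicator on the right masks the division by
    \<open>t\<close>.\<close>
  have inner_c: "has_bochner_integral lborel (\<lambda>c. h (t, c))
      (of_real (indicator {0<..} t * (exp (- t - (x / 2)\<^sup>2 / t) / 2)))" for t
  proof (cases "t > 0")
    case True
    have "has_bochner_integral lborel (\<lambda>c. of_real (t * exp (- t)) *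
           (of_real (indicator {0..} c * (exp (- t * c\<^sup>2) * c)) * J c))
           (of_real (t * exp (- t)) * of_real (exp (- x\<^sup>2 / (4 * t)) / (2 * t)))"
      unfolding J_def by (intro has_bochner_integral_mult_right has_bochner_integral_gaussian_bessel True)
    also have "(\<lambda>c. of_real (t * exp (- t)) * (of_real (indicator {0..} c * (exp (- t * c\<^sup>2) * c)) * J c)) = (\<lambda>c. h (t, c))"
      using True by (auto simp: fun_eq_iff h_def algebra_simps simp flip: exp_add of_real_mult)
    also have "of_real (t * exp (- t)) * of_real (exp (- x\<^sup>2 / (4 * t)) / (2 * t))
        = (of_real (indicator {0<..} t * (exp (- t - (x / 2)\<^sup>2 / t) / 2)) :: complex)"
    proof -
      have "exp (- t - (x / 2)\<^sup>2 / t) = exp (- t) * exp (- x\<^sup>2 / (4 * t))"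
        by (simp add: power_divide flip: exp_add)
      hence "t * exp (- t) * (exp (- x\<^sup>2 / (4 * t)) / (2 * t)) = indicator {0<..} t * (exp (- t - (x / 2)\<^sup>2 / t) / 2)"
        using True by simp
      thus ?thesis by (simp only: of_real_mult[symmetric])
    qed
    finally show ?thesis .
  next
    case False
    hence "(\<lambda>c. h (t, c)) = (\<lambda>_. 0)" by (auto simp: h_def indicator_def)
    thus ?thesis using False by (simp add: has_bochner_integral_iff)
  qed
  have inner_t: "has_bochner_integral lborel (\<lambda>t. h (t, c))
      (indicator {0..} c *\<^sub>R bessel_integrand (of_real x) c)" for c
  proof -
    have "has_bochner_integral lborel (\<lambda>t. of_real (indicator {0..} c * c) * J c *
        of_real (indicator {0..} t * (t * exp (- (1 + c\<^sup>2) * t))))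
        (of_real (indicator {0..} c * c) * J c * of_real (1 / (1 + c\<^sup>2)\<^sup>2))"
      by (intro has_bochner_integral_mult_right has_bochner_integral_of_real
            has_bochner_integral_exp_moment add_pos_nonneg) auto
    also have "(\<lambda>t. of_real (indicator {0..} c * c) * J c *
        of_real (indicator {0..} t * (t * exp (- (1 + c\<^sup>2) * t)))) = (\<lambda>t. h (t, c))"
      by (auto simp: fun_eq_iff h_def algebra_simps)
    also have "of_real (indicator {0..} c * c) * J c * of_real (1 / (1 + c\<^sup>2)\<^sup>2)
        = indicator {0..} c *\<^sub>R bessel_integrand (of_real x) c"
      using x by (simp add: bessel_integrand_eq J_def indicator_def)
    finally show ?thesis .
  qed
  \<comment> \<open>The bound \<open>|J_0| \<le> 1\<close> reduces the inner integral to the first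
    Gaussian moment, whose \<open>1 / (2 t)\<close> cancels the factor \<open>t\<close>; the
    remaining \<open>exp (- t) / 2\<close> is integrable, as Fubini requires.\<close>
  have norm_le: "norm (LINT c|lborel. norm (h (t, c))) \<le> indicator {0..} t * exp (- t) / 2" for t
  proof (cases "t > 0")
    case True
    have m: "has_bochner_integral lborel (\<lambda>c. t * exp (- t) * (indicator {0..} c * (exp (- t * c\<^sup>2) * c ^ (2 * 0 + 1))))
        (t * exp (- t) * (fact 0 / (2 * t ^ (0 + 1))))"
      by (intro has_bochner_integral_mult_right has_bochner_integral_gaussian_moment True)
    have "(LINT c|lborel. norm (h (t, c))) \<le>
          (LINT c|lborel. t * exp (- t) * (indicator {0..} c * (exp (- t * c\<^sup>2) * c ^ (2 * 0 + 1))))"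
    proof (rule integral_mono)
      show "integrable lborel (\<lambda>c. norm (h (t, c)))"
        using inner_c by (intro integrable_norm) (auto simp: has_bochner_integral_iff)
      show "integrable lborel (\<lambda>c. t * exp (- t) * (indicator {0..} c * (exp (- t * c\<^sup>2) * c ^ (2 * 0 + 1))))"
        using m by (simp only: has_bochner_integral_iff)
      fix c :: real
      show "norm (h (t, c)) \<le> t * exp (- t) * (indicator {0..} c * (exp (- t * c\<^sup>2) * c ^ (2 * 0 + 1)))"
      proof (cases "c \<ge> 0")
        case c: True
        have "norm (h (t, c)) = t * c * exp (- t * (1 + c\<^sup>2)) * norm (J c)"
          using True c by (simp add: h_def norm_mult)
        also have "\<dots> \<le> t * c * exp (- t * (1 + c\<^sup>2)) * 1"
          using True c J_le[OF c] by (intro mult_left_mono) auto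
        also have "\<dots> = t * exp (- t) * (indicator {0..} c * (exp (- t * c\<^sup>2) * c ^ (2 * 0 + 1)))"
          using c by (simp add: algebra_simps flip: exp_add)
        finally show ?thesis .
      qed (simp add: h_def)
    qed
    also have "\<dots> = indicator {0..} t * exp (- t) / 2"
      using m True by (simp add: has_bochner_integral_iff)
    finally show ?thesis by simp
  next
    case False
    hence "(\<lambda>c. h (t, c)) = (\<lambda>_. 0)" by (auto simp: h_def indicator_def)
    thus ?thesis by (auto simp: fun_eq_iff indicator_def)
  qed
  have "integrable lborel (\<lambda>t. indicator {0..} t * exp (- t) / 2 :: real)"
  proof -
    have "integrable lborel (\<lambda>t::real. exp (- t) * indicator {0..} t / 2)"
      using has_bochner_integral_power_exp[of 0]
      by (intro integrable_divide) (simp add: has_bochner_integral_iff)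
    thus ?thesis by (simp add: mult.commute)
  qed
  hence "integrable lborel (\<lambda>t. LINT c|lborel. norm (h (t, c)))"
  proof (rule Bochner_Integration.integrable_bound)
    show "(\<lambda>t. LINT c|lborel. norm (h (t, c))) \<in> borel_measurable lborel"
      using hm by measurable
    show "AE t in lborel. norm (LINT c|lborel. norm (h (t, c))) \<le> norm (indicator {0..} t * exp (- t) / 2 :: real)"
      using norm_le by (intro always_eventually allI) (smt (verit) real_norm_def)
  qed
  hence int: "integrable (lborel \<Otimes>\<^sub>M lborel) h"
    using inner_c hm by (intro lborel_pair.Fubini_integrable) (auto simp: has_bochner_integral_iff)
  have "(LINT c|lborel. LINT t|lborel. h (t, c)) = (LINT t|lborel. LINT c|lborel. h (t, c))"
    using lborel_pair.Fubini_integral[of "\<lambda>t c. h (t, c)"] int by simp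
  moreover have "integrable lborel (\<lambda>c. LINT t|lborel. h (t, c))"
    using lborel_pair.integrable_snd[of "\<lambda>t c. h (t, c)"] int by simp
  moreover have "(\<lambda>c. LINT t|lborel. h (t, c)) = (\<lambda>c. indicator {0..} c *\<^sub>R bessel_integrand (of_real x) c)"
    using inner_t by (auto simp: has_bochner_integral_iff)
  moreover have "(\<lambda>t. LINT c|lborel. h (t, c)) = (\<lambda>t. of_real (indicator {0<..} t * (exp (- t - (x / 2)\<^sup>2 / t) / 2)))"
    using inner_c by (auto simp: has_bochner_integral_iff)
  ultimately have 1: "(LINT c|lborel. indicator {0..} c *\<^sub>R bessel_integrand (of_real x) c)
      = of_real (LINT t|lborel. indicator {0<..} t * (exp (- t - (x / 2)\<^sup>2 / t) / 2))"
    and 2: "set_integrable lborel {0..} (bessel_integrand (of_real x))"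
    by (simp_all only: set_integrable_def integral_complex_of_real)
  have "(LINT t|lborel. indicator {0<..} t * (exp (- t - (x / 2)\<^sup>2 / t) / 2)) = macdonald_integral 1 ((x / 2)\<^sup>2) / 2"
  proof -
    have y: "(x / 2)\<^sup>2 > 0" using x by simp
    have "(\<lambda>t::real. t powr (1 - 1) * exp (- t - (x / 2)\<^sup>2 / t)) absolutely_integrable_on {0<..}"
      by (rule macdonald_absolutely_integrable[OF y])
    hence "(\<lambda>t::real. exp (- t - (x / 2)\<^sup>2 / t)) absolutely_integrable_on {0<..}"
      by (rule absolutely_integrable_spike[of _ _ "{}"]) auto
    \<comment> \<open>Absolute integrability refers to the completed measure; for a Borel function
      this agrees with integrability over \<open>lborel\<close>.\<close>
    hence "set_integrable lborel {0<..} (\<lambda>t::real. exp (- t - (x / 2)\<^sup>2 / t))"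
      unfolding set_integrable_def by (subst (asm) integrable_completion) auto
    moreover have "integral {0<..} (\<lambda>t::real. t powr (1 - 1) * exp (- t - (x / 2)\<^sup>2 / t))
        = integral {0<..} (\<lambda>t. exp (- t - (x / 2)\<^sup>2 / t))"
      by (rule Henstock_Kurzweil_Integration.integral_cong) simp
    ultimately have "(LINT t|lborel. indicator {0<..} t * exp (- t - (x / 2)\<^sup>2 / t)) = macdonald_integral 1 ((x / 2)\<^sup>2)"
      unfolding macdonald_integral_def set_lebesgue_integral_def
      using set_borel_integral_eq_integral(2)[of "{0<..}" "\<lambda>t. exp (- t - (x / 2)\<^sup>2 / t)"]
      by (simp only: set_lebesgue_integral_def real_scaleR_def)
    thus ?thesis by simp
  qed
  with 1 set_borel_integral_eq_integral[OF 2] show ?thesis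
    by (simp add: has_integral_iff set_lebesgue_integral_def)
qed

section \<open>Integrability, value and analytic continuation on the slit plane\<close>

theorem theorem5:
  fixes z :: complex
  assumes "z \<notin> \<real>\<^sub>\<le>\<^sub>0"
  shows "(z \<in> \<real> \<longrightarrow> bessel_integrand z integrable_on {0..}) \<and>
         (bessel_integrand z integrable_on {0..} \<longrightarrow>
            integral {0..} (bessel_integrand z) = z / 2 * bessel_K 1 z) \<and>
         (\<exists>F. F holomorphic_on (- \<real>\<^sub>\<le>\<^sub>0) \<and>
              (\<forall>x::real. x > 0 \<longrightarrow>
                 F (of_real x) = integral {0..} (bessel_integrand (of_real x))) \<and>
              F z = z / 2 * bessel_K 1 z)"
proof -
  have pos: "(bessel_integrand (of_real x) has_integral of_real x / 2 * bessel_K 1 (of_real x)) {0..}"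
    if "x > 0" for x
    unfolding bessel_K_1_eq_macdonald_integral[OF that] by (rule has_integral_bessel_integrand[OF that])
  have real: "\<exists>x>0. z = of_real x" if "z \<in> \<real>"
    using that assms by (auto elim!: Reals_cases)
  have "bessel_integrand z integrable_on {0..}" if "z \<in> \<real>"
    using real[OF that] pos by blast
  moreover have "integral {0..} (bessel_integrand z) = z / 2 * bessel_K 1 z"
    if "bessel_integrand z integrable_on {0..}"
  proof -
    \<comment> \<open>Integrability itself forces \<open>z\<close> onto the real axis, hence onto
      the positive axis where the value is known.\<close>
    have "z \<in> \<real>"
      using not_integrable_bessel_integrand[of z] that by (auto simp: complex_is_Real_iff)
    then obtain x where "x > 0" "z = of_real x"
      using real by blast
    thus ?thesis using integral_unique[OF pos] by simp
  qed
  \<comment> \<open>The witness for \<open>F\<close>. By the identity theorem on the connected slit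
    plane, no other holomorphic function has these values on the positive axis.\<close>
  moreover have "(\<lambda>z. z / 2 * bessel_K 1 z) holomorphic_on (- \<real>\<^sub>\<le>\<^sub>0)"
    by (intro holomorphic_intros bessel_K_1_holomorphic) auto
  ultimately show ?thesis
    using integral_unique[OF pos]
    by (intro conjI impI exI[of _ "\<lambda>z. z / 2 * bessel_K 1 z"]) simp_all
qed

end
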